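(* Let $F$ be a field of characteristic $\neq 2$ and let $r\ge 0$, $s>0$ be integers. The dimension over $F$ of $\mathfrak{G}_{r,s}$ is $$2^{r+s-1}-2^{\frac{r+s-1}{2}}\cos\left(\frac{(r+s+1)\pi}{4}\right).$$
   Context: Let $n=r+s$, let $e_1,\dots,e_n$ be the canonical basis of $F^n$, and let $Q$ be the symmetric bilinear form on $F^n$ with $Q(e_i,e_j)=0$ for $i\ne j$, $Q(e_i,e_i)=1$ for $1\le i\le r$, $Q(e_i,e_i)=-1$ for $r+1\le i\le r+s$. $C\ell(r,s)$ is the Clifford algebra over $F$ of $(F^n,Q)$, with sign convention $v\cdot v=-Q(v,v)1$. Let $c$ be the unique algebra anti-automorphism of $C\ell(r,s)$ with $c(v)=-v$ for $v\in F^n$, and let $\mathfrak{G}_{r,s}=\{\varphi\in C\ell(r,s):c(\varphi)=-\varphi\}$, a Lie algebra with bracket $[x,y]=xy-yx$. *)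

theory Defs
  imports Complex_Main "HOL-Algebra.QuotRing" "HOL-Algebra.Embedded_Algebras"
begin

subsection \<open>The quadratic space\<close>

text \<open>A vector of \<open>F\<^sup>n\<close> is a coordinate function with indices in \<open>{1..n}\<close>,
  extended by \<open>0\<close> to all of \<^typ>\<open>nat\<close>.\<close>

definition coord_space :: "nat \<Rightarrow> (nat \<Rightarrow> 'a::field) set" where
  "coord_space n = {v. \<forall>i. i \<notin> {1..n} \<longrightarrow> v i = 0}"

definition basis_vec :: "nat \<Rightarrow> nat \<Rightarrow> 'a::field" where
  "basis_vec i = (\<lambda>j. if j = i then 1 else 0)"

definition Qform :: "nat \<Rightarrow> nat \<Rightarrow> (nat \<Rightarrow> 'a::field) \<Rightarrow> (nat \<Rightarrow> 'a) \<Rightarrow> 'a" where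
  "Qform r s u v = (\<Sum>i = 1..r. u i * v i) - (\<Sum>i = r + 1..r + s. u i * v i)"

lemma Qform_basis_vec:
  assumes "i \<in> {1..r + s}" "j \<in> {1..r + s}"
  shows "Qform r s (basis_vec i) (basis_vec j) =
    (if i \<noteq> j then 0 else if i \<le> r then 1 else -1 :: 'a::field)"
proof -
  have eq: "basis_vec i k * basis_vec j k = (if k = i then (if i = j then 1 else 0) else 0 :: 'a)"
    for k by (auto simp: basis_vec_def)
  show ?thesis using assms unfolding Qform_def eq by (auto simp: sum.delta)
qed

subsection \<open>The tensor algebra\<close>

text \<open>The tensor algebra of \<open>F\<^sup>n\<close>: the degree \<open>k\<close> part \<open>(F\<^sup>n)\<^bsup>\<otimes>k\<^esup>\<close> has as basis the tensors
  \<open>e\<^bsub>i1\<^esub> \<otimes> \<dots> \<otimes> e\<^bsub>ik\<^esub>\<close>, which are encoded as words \<open>[i1, \<dots>, ik]\<close> over \<open>{1..n}\<close>. A tensor is its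
  finitely supported family of coefficients; the product extends concatenation of words.\<close>

definition tensor_algebra :: "nat \<Rightarrow> (nat list \<Rightarrow> 'a::field) ring" where
  "tensor_algebra n =
    \<lparr>carrier = {t. finite {w. t w \<noteq> 0} \<and> (\<forall>w. t w \<noteq> 0 \<longrightarrow> set w \<subseteq> {1..n})},
     mult = (\<lambda>t u w. \<Sum>k\<le>length w. t (take k w) * u (drop k w)),
     one = (\<lambda>w. if w = [] then 1 else 0),
     zero = (\<lambda>w. 0),
     add = (\<lambda>t u w. t w + u w)\<rparr>"

definition tensor_scalar :: "'a::field \<Rightarrow> nat list \<Rightarrow> 'a" where
  "tensor_scalar a = (\<lambda>w. if w = [] then a else 0)"

definition tensor_vec :: "(nat \<Rightarrow> 'a::field) \<Rightarrow> nat list \<Rightarrow> 'a" where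
  "tensor_vec v = (\<lambda>w. case w of [i] \<Rightarrow> v i | _ \<Rightarrow> 0)"

lemma ring_tensor_algebra: "ring (tensor_algebra n :: (nat list \<Rightarrow> 'a::field) ring)"
proof -
  let ?T = "tensor_algebra n :: (nat list \<Rightarrow> 'a) ring"
  let ?m = "\<lambda>t u (w :: nat list). \<Sum>k\<le>length w. t (take k w) * (u (drop k w) :: 'a)"
  note simps = tensor_algebra_def
  have mult_closed: "t \<otimes>\<^bsub>?T\<^esub> u \<in> carrier ?T" if "t \<in> carrier ?T" "u \<in> carrier ?T" for t u
  proof -
    let ?S = "(\<lambda>(a, b). a @ b) ` ({w. t w \<noteq> 0} \<times> {w. u w \<noteq> 0})"
    have sub: "{w. ?m t u w \<noteq> 0} \<subseteq> ?S"
    proof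
      fix w assume "w \<in> {w. ?m t u w \<noteq> 0}"
      then obtain k where "t (take k w) * u (drop k w) \<noteq> 0"
        by (auto elim: sum.not_neutral_contains_not_neutral)
      then show "w \<in> ?S"
        by (intro image_eqI[of _ _ "(take k w, drop k w)"]) auto
    qed
    have "finite ?S" using that by (auto simp: simps)
    then have "finite {w. ?m t u w \<noteq> 0}" using sub finite_subset by blast
    moreover have "set w \<subseteq> {1..n}" if "?m t u w \<noteq> 0" for w
    proof -
      from that sub have "w \<in> ?S" by blast
      then obtain a b where "w = a @ b" "t a \<noteq> 0" "u b \<noteq> 0" by auto
      then show ?thesis
        using \<open>t \<in> carrier ?T\<close> \<open>u \<in> carrier ?T\<close> by (simp add: simps)
    qed
    ultimately show ?thesis by (simp add: simps)
  qed
  have add_closed: "t \<oplus>\<^bsub>?T\<^esub> u \<in> carrier ?T" if "t \<in> carrier ?T" "u \<in> carrier ?T" for t u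
  proof -
    have "{w. t w + u w \<noteq> 0} \<subseteq> {w. t w \<noteq> 0} \<union> {w. u w \<noteq> 0}" by auto
    moreover have "finite ({w. t w \<noteq> 0} \<union> {w. u w \<noteq> 0})" using that by (simp add: simps)
    ultimately have "finite {w. t w + u w \<noteq> 0}" by (rule finite_subset)
    moreover have "set w \<subseteq> {1..n}" if "t w + u w \<noteq> 0" for w
      using that \<open>t \<in> carrier ?T\<close> \<open>u \<in> carrier ?T\<close> by (cases "t w = 0") (auto simp: simps)
    ultimately show ?thesis by (simp add: simps)
  qed
  have assoc: "?m (?m t u) v w = ?m t (?m u v) w" for t u v w
  proof -
    have "?m (?m t u) v w =
      (\<Sum>(k, j)\<in>Sigma {..length w} (\<lambda>k. {..k}).
         t (take j w) * u (drop j (take k w)) * v (drop k w))"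
      unfolding sum_distrib_right
      by (subst sum.Sigma[symmetric]) (auto simp: min_def intro!: sum.cong)
    also have "\<dots> = (\<Sum>(j, i)\<in>Sigma {..length w} (\<lambda>j. {..length w - j}).
         t (take j w) * u (take i (drop j w)) * v (drop (i + j) w))"
      by (rule sum.reindex_bij_witness[where j = "\<lambda>(k, j). (j, k - j)" and i = "\<lambda>(j, i). (i + j, j)"])
         (auto simp: drop_take)
    also have "\<dots> = ?m t (?m u v) w"
      unfolding sum_distrib_left
      by (subst sum.Sigma[symmetric]) (auto simp: mult.assoc intro!: sum.cong)
    finally show ?thesis .
  qed
  have one: "?m (\<lambda>w. if w = [] then 1 else 0) t w = t w" for t w
  proof -
    have "?m (\<lambda>w. if w = [] then 1 else 0) t w = (\<Sum>k\<le>length w. if k = 0 then t w else 0)"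
      by (intro sum.cong) auto
    then show ?thesis by simp
  qed
  have one': "?m t (\<lambda>w. if w = [] then 1 else 0) w = t w" for t w
  proof -
    have "?m t (\<lambda>w. if w = [] then 1 else 0) w = (\<Sum>k\<le>length w. if k = length w then t w else 0)"
      by (intro sum.cong) auto
    then show ?thesis by simp
  qed
  have "abelian_group ?T"
  proof (rule abelian_groupI)
    show "\<exists>y\<in>carrier ?T. y \<oplus>\<^bsub>?T\<^esub> x = \<zero>\<^bsub>?T\<^esub>" if "x \<in> carrier ?T" for x
      using that by (intro bexI[of _ "\<lambda>w. - x w"]) (auto simp: simps)
    show "x \<oplus>\<^bsub>?T\<^esub> y \<in> carrier ?T" if "x \<in> carrier ?T" "y \<in> carrier ?T" for x y
      using add_closed that .
  qed (simp_all add: simps add.assoc add.commute add.left_commute)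
  moreover have "monoid ?T"
  proof (rule monoidI)
    show "x \<otimes>\<^bsub>?T\<^esub> y \<in> carrier ?T" if "x \<in> carrier ?T" "y \<in> carrier ?T" for x y
      using mult_closed that .
    show "\<one>\<^bsub>?T\<^esub> \<in> carrier ?T" by (simp add: simps)
    show "x \<otimes>\<^bsub>?T\<^esub> y \<otimes>\<^bsub>?T\<^esub> z = x \<otimes>\<^bsub>?T\<^esub> (y \<otimes>\<^bsub>?T\<^esub> z)" for x y z
      using assoc[where t = x and u = y and v = z] by (simp add: simps del: length_take)
    show "\<one>\<^bsub>?T\<^esub> \<otimes>\<^bsub>?T\<^esub> x = x" for x using one[where t = x] by (simp add: simps)
    show "x \<otimes>\<^bsub>?T\<^esub> \<one>\<^bsub>?T\<^esub> = x" for x using one'[where t = x] by (simp add: simps)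
  qed
  ultimately show ?thesis
    by (rule ringI) (simp_all add: simps algebra_simps sum.distrib)
qed

lemma tensor_scalar_closed: "tensor_scalar a \<in> carrier (tensor_algebra n)"
  by (simp add: tensor_scalar_def tensor_algebra_def)

lemma tensor_vec_closed:
  assumes "v \<in> coord_space n"
  shows "tensor_vec v \<in> carrier (tensor_algebra n)"
proof -
  have *: "\<exists>i\<in>{1..n}. w = [i]" if "tensor_vec v w \<noteq> 0" for w
    using that assms by (auto simp: tensor_vec_def coord_space_def split: list.splits)
  then have "{w. tensor_vec v w \<noteq> 0} \<subseteq> (\<lambda>i. [i]) ` {1..n}" by auto
  then have "finite {w. tensor_vec v w \<noteq> 0}" using finite_subset by blast
  then show ?thesis using * by (fastforce simp: tensor_algebra_def)
qed

subsection \<open>The Clifford algebra\<close>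

text \<open>Sign convention \<open>v \<cdot> v = -Q(v,v) 1\<close>; the ideal is two-sided.\<close>

definition clifford_ideal :: "nat \<Rightarrow> nat \<Rightarrow> (nat list \<Rightarrow> 'a::field) set" where
  "clifford_ideal r s = (let T = tensor_algebra (r + s) in
     Idl\<^bsub>T\<^esub> {tensor_vec v \<otimes>\<^bsub>T\<^esub> tensor_vec v \<oplus>\<^bsub>T\<^esub> tensor_scalar (Qform r s v v) | v.
             v \<in> coord_space (r + s)})"

definition clifford :: "nat \<Rightarrow> nat \<Rightarrow> (nat list \<Rightarrow> 'a::field) set ring" where
  "clifford r s = tensor_algebra (r + s) Quot clifford_ideal r s"

lemma ideal_clifford_ideal:
  "ideal (clifford_ideal r s) (tensor_algebra (r + s) :: (nat list \<Rightarrow> 'a::field) ring)"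
proof -
  interpret ring "tensor_algebra (r + s) :: (nat list \<Rightarrow> 'a) ring"
    by (rule ring_tensor_algebra)
  show ?thesis unfolding clifford_ideal_def Let_def
    by (rule genideal_ideal) (auto intro!: tensor_vec_closed tensor_scalar_closed)
qed

lemma ring_clifford: "ring (clifford r s :: (nat list \<Rightarrow> 'a::field) set ring)"
  unfolding clifford_def by (rule ideal.quotient_is_ring[OF ideal_clifford_ideal])

definition clifford_scalar :: "nat \<Rightarrow> nat \<Rightarrow> 'a::field \<Rightarrow> (nat list \<Rightarrow> 'a) set" where
  "clifford_scalar r s a = clifford_ideal r s +>\<^bsub>tensor_algebra (r + s)\<^esub> tensor_scalar a"

definition clifford_vec :: "nat \<Rightarrow> nat \<Rightarrow> (nat \<Rightarrow> 'a::field) \<Rightarrow> (nat list \<Rightarrow> 'a) set" where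
  "clifford_vec r s v = clifford_ideal r s +>\<^bsub>tensor_algebra (r + s)\<^esub> tensor_vec v"

text \<open>The copy \<open>F\<cdot>1\<close> of the ground field. The vector space structure of the Clifford algebra over
  \<open>F\<close> is multiplication by its elements.\<close>

definition clifford_scalars :: "nat \<Rightarrow> nat \<Rightarrow> (nat list \<Rightarrow> 'a::field) set set" where
  "clifford_scalars r s = range (clifford_scalar r s)"

subsection \<open>Conjugation and the Lie algebra of anti-invariant elements\<close>

definition opposite_ring :: "('a, 'b) ring_scheme \<Rightarrow> ('a, 'b) ring_scheme" where
  "opposite_ring R = R\<lparr>mult := (\<lambda>x y. y \<otimes>\<^bsub>R\<^esub> x)\<rparr>"

definition clifford_anti_automorphism ::
    "nat \<Rightarrow> nat \<Rightarrow> ((nat list \<Rightarrow> 'a::field) set \<Rightarrow> (nat list \<Rightarrow> 'a) set) \<Rightarrow> bool" where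
  "clifford_anti_automorphism r s c \<longleftrightarrow>
     c \<in> ring_iso (clifford r s) (opposite_ring (clifford r s)) \<and>
     (\<forall>a. \<forall>x\<in>carrier (clifford r s).
        c (clifford_scalar r s a \<otimes>\<^bsub>clifford r s\<^esub> x) = clifford_scalar r s a \<otimes>\<^bsub>clifford r s\<^esub> c x)"

text \<open>Extensionality makes \<open>c\<close> unique as a HOL function: off the carrier its value is fixed.\<close>

definition clifford_conj ::
    "nat \<Rightarrow> nat \<Rightarrow> (nat list \<Rightarrow> 'a::field) set \<Rightarrow> (nat list \<Rightarrow> 'a) set" where
  "clifford_conj r s = (THE c.
     c \<in> extensional (carrier (clifford r s)) \<and>
     clifford_anti_automorphism r s c \<and>
     (\<forall>v\<in>coord_space (r + s). c (clifford_vec r s v) = \<ominus>\<^bsub>clifford r s\<^esub> clifford_vec r s v))"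

definition clifford_lie :: "nat \<Rightarrow> nat \<Rightarrow> (nat list \<Rightarrow> 'a::field) set set" where
  "clifford_lie r s =
     {\<phi> \<in> carrier (clifford r s). clifford_conj r s \<phi> = \<ominus>\<^bsub>clifford r s\<^esub> \<phi>}"

end

theory Submission
  imports Defs
begin

text \<open>Sorting the letters of a word by \<open>e\<^sub>i e\<^sub>j = - e\<^sub>j e\<^sub>i\<close> and \<open>e\<^sub>i\<^sup>2 = \<plusminus>1\<close> turns it into a sign times
  the sorted product of the letters that occur an odd number of times. As this sign is multiplicative
  up to a bicharacter of the parity sets, the coordinate functionals that read off the normal form
  have a two-sided ideal as common kernel. It contains the generators \<open>v \<otimes> v + Q(v, v)\<close>, so the \<open>2\<^sup>n\<close>
  sorted products \<open>e\<^sub>J\<close> are a basis of the Clifford algebra. Conjugation reverses words up to the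
  sign \<open>(-1)\<^sup>k\<close>, hence multiplies \<open>e\<^sub>J\<close> with \<open>card J = k\<close> by \<open>(-1)\<^bsup>k(k+1)/2\<^esup>\<close>, the real part of
  \<open>(1 + \<i>) \<i>\<^sup>k\<close>. The anti-invariant elements are spanned by the \<open>e\<^sub>J\<close> with \<open>k mod 4\<close> equal to \<open>1\<close> or
  \<open>2\<close>, and the binomial theorem for \<open>(1 + \<i>)\<^bsup>n+1\<^esup>\<close> counts them.\<close>

subsection \<open>Words and signs\<close>

text \<open>Squares of letters become scalars, so the parity set is what remains of a word.
  Concatenation turns into symmetric difference, the addition of an F_2-vector space.\<close>

definition odd_letters :: "nat list \<Rightarrow> nat set" where
  "odd_letters w = {i. odd (count_list w i)}"

lemma odd_letters_Nil [simp]: "odd_letters [] = {}"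
  by (simp add: odd_letters_def)

lemma odd_letters_Cons [simp]: "odd_letters (i # w) = sym_diff {i} (odd_letters w)"
  by (auto simp: odd_letters_def)

lemma odd_letters_append: "odd_letters (u @ v) = sym_diff (odd_letters u) (odd_letters v)"
  by (auto simp: odd_letters_def)

lemma odd_letters_rev [simp]: "odd_letters (rev w) = odd_letters w"
  by (simp add: odd_letters_def)

lemma odd_letters_subset: "odd_letters w \<subseteq> set w"
  by (auto simp: odd_letters_def intro: ccontr)

lemma finite_odd_letters [simp]: "finite (odd_letters w)"
  using odd_letters_subset finite_subset by blast

lemma odd_letters_distinct: "distinct w \<Longrightarrow> odd_letters w = set w"
  by (induction w) auto

text \<open>Removing \<open>i\<close> divides the product by \<open>f i\<close>, which is the same
  as multiplying since \<open>f i\<close> is its own inverse. Products of signs are thus characters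
  for symmetric difference.\<close>

lemma prod_involution_sym_diff:
  fixes f :: "'b \<Rightarrow> 'a::comm_ring_1"
  assumes "finite A" and "f i * f i = 1"
  shows "prod f (sym_diff {i} A) = f i * prod f A"
proof (cases "i \<in> A")
  case True
  then have "sym_diff {i} A = A - {i}" by auto
  moreover have "prod f A = f i * prod f (A - {i})"
    using assms(1) True by (rule prod.remove)
  ultimately show ?thesis using assms(2) by (simp add: mult.assoc[symmetric])
next
  case False
  then have "sym_diff {i} A = insert i A" by auto
  then show ?thesis using assms(1) False by simp
qed

lemma prod_list_involution:
  fixes f :: "nat \<Rightarrow> 'a::comm_ring_1"
  assumes "\<And>i. f i * f i = 1"
  shows "prod_list (map f w) = prod f (odd_letters w)"
  by (induction w) (simp_all only: list.map prod_list.Nil prod_list.Cons odd_letters_Nil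
      odd_letters_Cons prod_involution_sym_diff[OF finite_odd_letters assms] prod.empty)

text \<open>Moving \<open>e\<^sub>i\<close> into its place in a sorted product multiplies the product by \<open>tau r i j\<close> for every
  factor \<open>e\<^sub>j\<close>: \<open>-1\<close> when \<open>e\<^sub>j\<close> has to be passed, and \<open>e\<^sub>i\<^sup>2\<close> when \<open>j = i\<close>.\<close>

definition tau :: "nat \<Rightarrow> nat \<Rightarrow> nat \<Rightarrow> 'a::field" where
  "tau r i j = (if j < i \<or> (j = i \<and> i \<le> r) then -1 else 1)"

lemma tau_square: "tau r i j * tau r i j = 1"
  by (simp add: tau_def)

lemma prod_tau_square: "prod (tau r i) A * prod (tau r i) A = 1"
  by (simp add: prod.distrib[symmetric] tau_square)

text \<open>Insertion sort from the right: once the tail is reduced to its sorted parity set, the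
  head is moved into its place there.\<close>

fun word_sign :: "nat \<Rightarrow> nat list \<Rightarrow> 'a::field" where
  "word_sign r [] = 1"
| "word_sign r (i # w) = prod (tau r i) (odd_letters w) * word_sign r w"

text \<open>The extra factor is a bicharacter of the two parity sets and sees \<open>u\<close> and
  \<open>v\<close> only through them. This controls left and right multiplication by a word on
  coordinates.\<close>

lemma word_sign_append:
  "(word_sign r (u @ v) :: 'a::field) =
     word_sign r u * word_sign r v * (\<Prod>i\<in>odd_letters u. prod (tau r i) (odd_letters v))"
proof -
  have "(word_sign r (u @ v) :: 'a) =
     word_sign r u * word_sign r v * prod_list (map (\<lambda>i. prod (tau r i) (odd_letters v)) u)"
  proof (induction u)
    case (Cons i u)
    have "prod (tau r i) (odd_letters (u @ v)) =
      (prod (tau r i) (odd_letters u) * prod (tau r i) (odd_letters v) :: 'a)"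
      by (simp add: prod_list_involution[symmetric] tau_square)
    then show ?case using Cons by (simp add: ac_simps)
  qed simp
  then show ?thesis by (simp add: prod_list_involution prod_tau_square)
qed

lemma word_sign_sorted:
  assumes "sorted_wrt (<) w"
  shows "word_sign r w = 1"
  using assms
proof (induction w)
  case (Cons i w)
  then have "distinct w" by (simp add: strict_sorted_iff)
  then have "odd_letters w = set w" by (rule odd_letters_distinct)
  moreover have "prod (tau r i) (set w) = 1"
    using Cons.prems by (intro prod.neutral) (auto simp: tau_def)
  ultimately show ?case using Cons by simp
qed simp

text \<open>This is (-1)^(k(k+1)/2): reversing \<open>k\<close> anticommuting letters costs
  (-1)^(k(k-1)/2), and negating each of them (-1)^k.\<close>

definition rev_sign :: "nat \<Rightarrow> 'a::comm_ring_1" where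
  "rev_sign k = (if k mod 4 \<in> {1, 2} then -1 else 1)"

lemma rev_sign_Suc: "rev_sign (Suc k) = (-1) ^ Suc k * rev_sign k"
proof -
  have "k mod 4 \<in> {0,1,2,3}" by auto
  moreover have "Suc k mod 4 = (if k mod 4 = 3 then 0 else Suc (k mod 4))" by (simp add: mod_Suc)
  moreover have "even k \<longleftrightarrow> k mod 4 = 0 \<or> k mod 4 = 2" by presburger
  ultimately show ?thesis by (auto simp: rev_sign_def)
qed

text \<open>By induction on the word. Its head \<open>i\<close> moves from the front to the back,
  and the two insertion signs differ by -1 for every other letter of odd multiplicity.\<close>

lemma word_sign_rev:
  "(-1) ^ length w * word_sign r (rev w) = rev_sign (card (odd_letters w)) * (word_sign r w :: 'a::field)"
proof (induction w)
  case Nil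
  then show ?case by (simp add: rev_sign_def)
next
  case (Cons i w)
  let ?P = "odd_letters w"
  \<comment> \<open>Of two distinct letters exactly one has to pass the other.\<close>
  have swap: "(tau r j i :: 'a) = tau r i j * (if j = i then 1 else -1)" for j
    by (auto simp: tau_def)
  have "(\<Prod>j\<in>?P. if j = i then 1 else -1 :: 'a) = (\<Prod>j\<in>?P - {i}. -1)"
    by (intro prod.mono_neutral_cong_right) auto
  then have "(\<Prod>j\<in>?P. tau r j i) = prod (tau r i) ?P * (-1 :: 'a) ^ card (?P - {i})"
    by (simp add: swap prod.distrib)
  then have "(-1) ^ length (i # w) * word_sign r (rev (i # w)) =
    (-1) ^ Suc (card (?P - {i})) * ((-1) ^ length w * word_sign r (rev w)) * (prod (tau r i) ?P :: 'a)"
    by (simp add: word_sign_append)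
  also have "\<dots> = ((-1) ^ Suc (card (?P - {i})) * rev_sign (card ?P)) * word_sign r (i # w)"
    by (subst Cons) (simp only: word_sign.simps ac_simps)
  \<comment> \<open>Prefixing \<open>i\<close> switches between \<open>?P - {i}\<close> and
    \<open>insert i ?P\<close>; in either direction \<open>rev_sign\<close> changes by the factor of
    \<open>rev_sign_Suc\<close>.\<close>
  also have "(-1) ^ Suc (card (?P - {i})) * rev_sign (card ?P) = (rev_sign (card (odd_letters (i # w))) :: 'a)"
  proof (cases "i \<in> ?P")
    case True
    then have eq: "odd_letters (i # w) = ?P - {i}" by auto
    have "card ?P = Suc (card (?P - {i}))" using True by (simp only: card.remove[OF finite_odd_letters])
    then show ?thesis unfolding eq
      by (simp add: rev_sign_Suc mult.assoc[symmetric] power_mult_distrib[symmetric])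
  next
    case False
    then have "odd_letters (i # w) = insert i ?P" "?P - {i} = ?P" by auto
    then show ?thesis using False by (simp add: rev_sign_Suc)
  qed
  finally show ?case .
qed

subsection \<open>Linear functionals on tensors\<close>

definition word_tensor :: "nat list \<Rightarrow> nat list \<Rightarrow> 'a::field" where
  "word_tensor w = (\<lambda>v. if v = w then 1 else 0)"

text \<open>The linear functional with prescribed values on the basis of words; the sum is finite
  for tensors in the carrier.\<close>

definition tensor_eval :: "(nat list \<Rightarrow> 'a) \<Rightarrow> (nat list \<Rightarrow> 'a::field) \<Rightarrow> 'a" where
  "tensor_eval f t = (\<Sum>w | t w \<noteq> 0. t w * f w)"

lemma tensor_eval_superset:
  assumes "finite A" and "{w. t w \<noteq> 0} \<subseteq> A"
  shows "tensor_eval f t = (\<Sum>w\<in>A. t w * f w)"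
  unfolding tensor_eval_def using assms by (intro sum.mono_neutral_left) auto

lemma word_tensor_closed:
  "word_tensor w \<in> carrier (tensor_algebra n) \<longleftrightarrow> set w \<subseteq> {1..n}"
  by (auto simp: word_tensor_def tensor_algebra_def)

lemma tensor_mult:
  "(t \<otimes>\<^bsub>tensor_algebra n\<^esub> u) w = (\<Sum>k\<le>length w. t (take k w) * u (drop k w))"
  by (simp add: tensor_algebra_def)

lemma tensor_scalar_mult:
  "tensor_scalar a \<otimes>\<^bsub>tensor_algebra n\<^esub> t = (\<lambda>w. a * t w)"
proof
  fix w
  have "(tensor_scalar a \<otimes>\<^bsub>tensor_algebra n\<^esub> t) w = (\<Sum>k\<le>length w. if k = 0 then a * t w else 0)"
    unfolding tensor_mult by (intro sum.cong) (auto simp: tensor_scalar_def)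
  then show "(tensor_scalar a \<otimes>\<^bsub>tensor_algebra n\<^esub> t) w = a * t w" by simp
qed

lemma tensor_scalar_commute:
  "t \<otimes>\<^bsub>tensor_algebra n\<^esub> tensor_scalar a = tensor_scalar a \<otimes>\<^bsub>tensor_algebra n\<^esub> t"
proof
  fix w
  have "(t \<otimes>\<^bsub>tensor_algebra n\<^esub> tensor_scalar a) w =
      (\<Sum>k\<le>length w. if k = length w then a * t w else 0)"
    unfolding tensor_mult by (intro sum.cong) (auto simp: tensor_scalar_def)
  then show "(t \<otimes>\<^bsub>tensor_algebra n\<^esub> tensor_scalar a) w =
      (tensor_scalar a \<otimes>\<^bsub>tensor_algebra n\<^esub> t) w"
    by (simp add: tensor_scalar_mult)
qed

lemma word_tensor_mult:
  "word_tensor u \<otimes>\<^bsub>tensor_algebra n\<^esub> word_tensor v = (word_tensor (u @ v) :: nat list \<Rightarrow> 'a::field)"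
proof
  fix w
  have "(word_tensor u \<otimes>\<^bsub>tensor_algebra n\<^esub> word_tensor v) w =
    (\<Sum>k\<le>length w. if k = length u then (if w = u @ v then 1 else 0 :: 'a) else 0)"
    unfolding tensor_mult
  proof (intro sum.cong refl)
    fix k assume "k \<in> {..length w}"
    \<comment> \<open>Only the cut after \<open>length u\<close> letters can separate
      \<open>u\<close> from \<open>v\<close>.\<close>
    then have eq: "take k w = u \<and> drop k w = v \<longleftrightarrow> k = length u \<and> w = u @ v"
      by (metis append_eq_conv_conj append_take_drop_id atMost_iff length_take min.absorb2)
    have "word_tensor u (take k w) * word_tensor v (drop k w) =
        (if take k w = u \<and> drop k w = v then 1 else 0 :: 'a)"
      by (simp add: word_tensor_def)
    also have "\<dots> = (if k = length u then (if w = u @ v then 1 else 0) else 0)"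
      unfolding eq by simp
    finally show "word_tensor u (take k w) * word_tensor v (drop k w) =
        (if k = length u then (if w = u @ v then 1 else 0 :: 'a) else 0)" .
  qed
  then show "(word_tensor u \<otimes>\<^bsub>tensor_algebra n\<^esub> word_tensor v) w = (word_tensor (u @ v) w :: 'a)"
    by (auto simp: word_tensor_def)
qed

lemma tensor_one: "\<one>\<^bsub>tensor_algebra n\<^esub> = word_tensor []"
  by (simp add: tensor_algebra_def word_tensor_def)

lemma tensor_zero: "\<zero>\<^bsub>tensor_algebra n\<^esub> = (\<lambda>w. 0)"
  by (simp add: tensor_algebra_def)

lemma tensor_add: "t \<oplus>\<^bsub>tensor_algebra n\<^esub> u = (\<lambda>w. t w + u w)"
  by (simp add: tensor_algebra_def)

lemma tensor_scalar_one: "tensor_scalar 1 = \<one>\<^bsub>tensor_algebra n\<^esub>"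
  by (simp add: tensor_algebra_def tensor_scalar_def)

lemma tensor_uminus:
  assumes "t \<in> carrier (tensor_algebra n :: (nat list \<Rightarrow> 'a::field) ring)"
  shows "\<ominus>\<^bsub>tensor_algebra n\<^esub> t = (\<lambda>w. - t w)"
proof -
  interpret T: ring "tensor_algebra n :: (nat list \<Rightarrow> 'a) ring" by (rule ring_tensor_algebra)
  have "(\<lambda>w. - t w) \<in> carrier (tensor_algebra n)" using assms by (simp add: tensor_algebra_def)
  then show ?thesis using assms
    by (intro T.minus_equality) (simp_all add: tensor_add tensor_zero)
qed

lemma tensor_minus:
  assumes "u \<in> carrier (tensor_algebra n :: (nat list \<Rightarrow> 'a::field) ring)"
  shows "t \<ominus>\<^bsub>tensor_algebra n\<^esub> u = (\<lambda>w. t w - u w)"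
  using assms by (simp add: a_minus_def tensor_add tensor_uminus)

text \<open>A tensor has finite support, so it arises from zero by adding one multiple of a word at
  a time. Claims linear in the tensor are thereby reduced to words.\<close>

lemma tensor_induct [consumes 1, case_names zero add]:
  assumes "t \<in> carrier (tensor_algebra n :: (nat list \<Rightarrow> 'a::field) ring)"
    and zero: "P \<zero>\<^bsub>tensor_algebra n\<^esub>"
    and add: "\<And>t a w. t \<in> carrier (tensor_algebra n) \<Longrightarrow> set w \<subseteq> {1..n} \<Longrightarrow> P t \<Longrightarrow>
      P (t \<oplus>\<^bsub>tensor_algebra n\<^esub> (tensor_scalar a \<otimes>\<^bsub>tensor_algebra n\<^esub> word_tensor w))"
  shows "P t"
proof -
  have "P t" if "finite A" "t \<in> carrier (tensor_algebra n)" "{w. t w \<noteq> 0} \<subseteq> A" for A t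
    using that
  proof (induction A arbitrary: t rule: finite_induct)
    case empty
    then have "t = \<zero>\<^bsub>tensor_algebra n\<^esub>" by (auto simp: tensor_zero)
    then show ?case using zero by simp
  next
    case (insert w A)
    let ?t = "t(w := 0)"
    have sub: "{v. ?t v \<noteq> 0} \<subseteq> {v. t v \<noteq> 0}" by auto
    have carrier: "?t \<in> carrier (tensor_algebra n)"
      using insert.prems(1) finite_subset[OF sub] by (simp add: tensor_algebra_def)
    have "P ?t" using insert.prems by (intro insert.IH carrier) auto
    show ?case
    proof (cases "t w = 0")
      case True
      then have "?t = t" by auto
      then show ?thesis using \<open>P ?t\<close> by simp
    next
      case False
      then have "set w \<subseteq> {1..n}" using insert.prems(1) by (simp add: tensor_algebra_def)
      moreover have "t = ?t \<oplus>\<^bsub>tensor_algebra n\<^esub>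
          (tensor_scalar (t w) \<otimes>\<^bsub>tensor_algebra n\<^esub> word_tensor w)"
        by (auto simp: tensor_add tensor_scalar_mult word_tensor_def)
      ultimately show ?thesis using add[OF carrier _ \<open>P ?t\<close>] by metis
    qed
  qed
  then show ?thesis using assms(1) by (auto simp: tensor_algebra_def)
qed

lemma tensor_eval_zero [simp]: "tensor_eval f \<zero>\<^bsub>tensor_algebra n\<^esub> = 0"
  by (simp add: tensor_eval_def tensor_zero)

lemma tensor_eval_add:
  assumes "t \<in> carrier (tensor_algebra n)" and "u \<in> carrier (tensor_algebra n)"
  shows "tensor_eval f (t \<oplus>\<^bsub>tensor_algebra n\<^esub> u) = tensor_eval f t + tensor_eval f u"
proof -
  let ?A = "{w. t w \<noteq> 0} \<union> {w. u w \<noteq> 0}"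
  have "finite ?A" using assms by (simp add: tensor_algebra_def)
  then have "tensor_eval f t = (\<Sum>w\<in>?A. t w * f w)" "tensor_eval f u = (\<Sum>w\<in>?A. u w * f w)"
    "tensor_eval f (\<lambda>w. t w + u w) = (\<Sum>w\<in>?A. (t w + u w) * f w)"
    by (intro tensor_eval_superset; auto)+
  then show ?thesis by (simp add: tensor_add algebra_simps sum.distrib)
qed

lemma tensor_eval_scalar:
  "tensor_eval f (tensor_scalar a \<otimes>\<^bsub>tensor_algebra n\<^esub> t) = a * tensor_eval f t"
  by (cases "a = 0") (simp_all add: tensor_eval_def tensor_scalar_mult sum_distrib_left mult.assoc)

lemma tensor_eval_minus:
  assumes "t \<in> carrier (tensor_algebra n :: (nat list \<Rightarrow> 'a::field) ring)"
    and "u \<in> carrier (tensor_algebra n)"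
  shows "tensor_eval f (t \<ominus>\<^bsub>tensor_algebra n\<^esub> u) = tensor_eval f t - tensor_eval f u"
proof -
  interpret T: ring "tensor_algebra n :: (nat list \<Rightarrow> 'a) ring" by (rule ring_tensor_algebra)
  have "\<ominus>\<^bsub>tensor_algebra n\<^esub> u = tensor_scalar (-1) \<otimes>\<^bsub>tensor_algebra n\<^esub> u"
    using assms by (simp add: tensor_uminus tensor_scalar_mult)
  then have "tensor_eval f (\<ominus>\<^bsub>tensor_algebra n\<^esub> u) = - tensor_eval f u"
    by (simp add: tensor_eval_scalar)
  then show ?thesis using assms by (simp add: a_minus_def tensor_eval_add)
qed

lemma tensor_eval_word [simp]: "tensor_eval f (word_tensor w) = f w"
  by (subst tensor_eval_superset[of "{w}"]) (auto simp: word_tensor_def)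

lemma tensor_eval_cmult: "tensor_eval (\<lambda>w. c * f w) t = c * tensor_eval f t"
  by (simp add: tensor_eval_def sum_distrib_left ac_simps)

lemma tensor_eval_const_zero [simp]: "tensor_eval (\<lambda>w. 0) t = 0"
  by (simp add: tensor_eval_def)

text \<open>Both sides are bilinear, which reduces the claim to two words, whose product is their
  concatenation.\<close>

lemma tensor_eval_mult:
  assumes t: "t \<in> carrier (tensor_algebra n :: (nat list \<Rightarrow> 'a::field) ring)"
    and u: "u \<in> carrier (tensor_algebra n)"
  shows "tensor_eval f (t \<otimes>\<^bsub>tensor_algebra n\<^esub> u) =
    tensor_eval (\<lambda>a. tensor_eval (\<lambda>b. f (a @ b)) u) t"
proof -
  let ?T = "tensor_algebra n :: (nat list \<Rightarrow> 'a) ring"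
  interpret T: ring ?T by (rule ring_tensor_algebra)
  note [simp] = tensor_scalar_closed word_tensor_closed tensor_eval_add tensor_eval_scalar
  have word: "tensor_eval f (word_tensor a \<otimes>\<^bsub>?T\<^esub> u) = tensor_eval (\<lambda>b. f (a @ b)) u"
    if a: "set a \<subseteq> {1..n}" for a
    using u
  proof (induction u rule: tensor_induct)
    case zero
    then show ?case using a by simp
  next
    case (add u c w)
    have "word_tensor a \<otimes>\<^bsub>?T\<^esub> (u \<oplus>\<^bsub>?T\<^esub> tensor_scalar c \<otimes>\<^bsub>?T\<^esub> word_tensor w) =
      word_tensor a \<otimes>\<^bsub>?T\<^esub> u \<oplus>\<^bsub>?T\<^esub> tensor_scalar c \<otimes>\<^bsub>?T\<^esub> word_tensor (a @ w)"
      using add.hyps a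
      by (simp add: T.r_distr T.m_assoc[symmetric] tensor_scalar_commute[where t = "word_tensor a"])
        (simp add: T.m_assoc word_tensor_mult)
    then show ?case using add a by simp
  qed
  show ?thesis using t
  proof (induction t rule: tensor_induct)
    case zero
    then show ?case using u by simp
  next
    case (add t c w)
    then show ?case using u by (simp add: T.l_distr T.m_assoc word)
  qed
qed

section \<open>Signed reversal, the lift of the conjugation to tensors\<close>

definition tensor_rev :: "(nat list \<Rightarrow> 'a::field) \<Rightarrow> nat list \<Rightarrow> 'a" where
  "tensor_rev t = (\<lambda>w. (-1) ^ length w * t (rev w))"

lemma tensor_rev_support: "{w. tensor_rev t w \<noteq> 0} = rev ` {w. t w \<noteq> 0}"
  by (auto simp: tensor_rev_def intro: rev_image_eqI[of "rev _"])

lemma tensor_rev_closed: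
  assumes "t \<in> carrier (tensor_algebra n)"
  shows "tensor_rev t \<in> carrier (tensor_algebra n)"
proof -
  have "set w \<subseteq> {1..n}" if "tensor_rev t w \<noteq> 0" for w
  proof -
    have "t (rev w) \<noteq> 0" using that by (auto simp: tensor_rev_def)
    moreover have "\<forall>v. t v \<noteq> 0 \<longrightarrow> set v \<subseteq> {1..n}" using assms by (simp add: tensor_algebra_def)
    ultimately have "set (rev w) \<subseteq> {1..n}" by blast
    then show ?thesis by (simp only: set_rev)
  qed
  then show ?thesis using assms by (simp add: tensor_algebra_def tensor_rev_support)
qed

lemma tensor_rev_rev [simp]: "tensor_rev (tensor_rev t) = t"
  by (simp add: tensor_rev_def mult.assoc[symmetric] power_mult_distrib[symmetric])

lemma tensor_eval_rev: "tensor_eval f (tensor_rev t) = tensor_eval (\<lambda>w. (-1) ^ length w * f (rev w)) t"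
  unfolding tensor_eval_def tensor_rev_support
  by (subst sum.reindex) (auto simp: tensor_rev_def ac_simps)

lemma tensor_rev_add:
  "tensor_rev (t \<oplus>\<^bsub>tensor_algebra n\<^esub> u) = tensor_rev t \<oplus>\<^bsub>tensor_algebra n\<^esub> tensor_rev u"
  by (simp add: tensor_rev_def tensor_add algebra_simps)

lemma tensor_rev_mult:
  "tensor_rev (t \<otimes>\<^bsub>tensor_algebra n\<^esub> u) = tensor_rev u \<otimes>\<^bsub>tensor_algebra n\<^esub> tensor_rev t"
proof
  fix w
  have "tensor_rev (t \<otimes>\<^bsub>tensor_algebra n\<^esub> u) w =
    (\<Sum>k\<le>length w. (-1) ^ length w * (t (take k (rev w)) * u (drop k (rev w))))"
    by (simp add: tensor_rev_def tensor_algebra_def sum_distrib_left)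
  also have "\<dots> = (\<Sum>k\<le>length w. tensor_rev u (take k w) * tensor_rev t (drop k w))"
  \<comment> \<open>Cutting the reversed word after \<open>k\<close> letters cuts the original
    \<open>k\<close> letters before its end, and the sign splits according to the two
    lengths.\<close>
  proof (rule sum.reindex_bij_witness[of _ "\<lambda>k. length w - k" "\<lambda>k. length w - k"])
    fix k assume "k \<in> {..length w}"
    then have k: "k \<le> length w" by simp
    have "(-1) ^ length w = (-1) ^ (length w - k) * (-1 :: 'a) ^ k"
      using k by (simp add: power_add[symmetric])
    then show "tensor_rev u (take (length w - k) w) * tensor_rev t (drop (length w - k) w) =
      (-1) ^ length w * (t (take k (rev w)) * u (drop k (rev w)))"
      using k by (simp add: tensor_rev_def take_rev drop_rev ac_simps)
  qed auto
  also have "\<dots> = (tensor_rev u \<otimes>\<^bsub>tensor_algebra n\<^esub> tensor_rev t) w"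
    by (simp add: tensor_algebra_def)
  finally show "tensor_rev (t \<otimes>\<^bsub>tensor_algebra n\<^esub> u) w =
    (tensor_rev u \<otimes>\<^bsub>tensor_algebra n\<^esub> tensor_rev t) w" .
qed

lemma tensor_rev_scalar [simp]: "tensor_rev (tensor_scalar a) = tensor_scalar a"
  by (auto simp: tensor_rev_def tensor_scalar_def)

lemma tensor_vec_basis_vec: "tensor_vec (basis_vec i) = word_tensor [i]"
  by (auto simp: tensor_vec_def basis_vec_def word_tensor_def split: list.splits)

lemma tensor_rev_vec:
  assumes "v \<in> coord_space n"
  shows "tensor_rev (tensor_vec v) = \<ominus>\<^bsub>tensor_algebra n\<^esub> (tensor_vec v)"
proof -
  have "tensor_rev (tensor_vec v) w = - tensor_vec v w" for w
  proof (cases "length w = 1")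
    case True
    then obtain i where "w = [i]" by (auto simp: length_Suc_conv)
    then show ?thesis by (simp add: tensor_rev_def tensor_vec_def)
  next
    case False
    then have "tensor_vec v u = 0" if "length u = length w" for u
      using that by (auto simp: tensor_vec_def split: list.splits)
    then show ?thesis by (simp add: tensor_rev_def)
  qed
  then show ?thesis by (auto simp: tensor_uminus[OF tensor_vec_closed[OF assms]])
qed

lemma tensor_eval_vec_mult:
  assumes "v \<in> coord_space n" and "u \<in> coord_space n"
  shows "tensor_eval f (tensor_vec v \<otimes>\<^bsub>tensor_algebra n\<^esub> tensor_vec u) =
    (\<Sum>i\<in>{1..n}. \<Sum>j\<in>{1..n}. v i * u j * f [i, j])"
proof -
  have vec: "tensor_eval g (tensor_vec v) = (\<Sum>i\<in>{1..n}. v i * g [i])"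
    if "v \<in> coord_space n" for g and v :: "nat \<Rightarrow> 'a"
  proof -
    have "\<exists>i\<in>{1..n}. w = [i]" if "tensor_vec v w \<noteq> 0" for w
      using that \<open>v \<in> coord_space n\<close>
      by (auto simp: tensor_vec_def coord_space_def split: list.splits)
    then have "tensor_eval g (tensor_vec v) = (\<Sum>w\<in>(\<lambda>i. [i]) ` {1..n}. tensor_vec v w * g w)"
      by (intro tensor_eval_superset) auto
    also have "\<dots> = (\<Sum>i\<in>{1..n}. v i * g [i])"
      by (subst sum.reindex) (auto simp: tensor_vec_def inj_on_def)
    finally show ?thesis .
  qed
  show ?thesis using assms
    by (simp add: tensor_eval_mult tensor_vec_closed vec sum_distrib_left mult.assoc)
qed

subsection \<open>Coordinates on the Clifford algebra\<close>

text \<open>\<open>ground\<close> fixes the field, which \<open>r\<close> and \<open>s\<close> alone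
  would not. The hypothesis serves to halve in \<open>coord_generator\<close> and to get
  \<open>a = 0\<close> from \<open>a = - a\<close> in \<open>clifford_lie_eq\<close>.\<close>

locale clifford_char_neq_2 =
  fixes r s :: nat and ground :: "'a::field itself"
  assumes two_neq_0: "(2 :: 'a) \<noteq> 0"
begin

abbreviation T :: "(nat list \<Rightarrow> 'a) ring" where "T \<equiv> tensor_algebra (r + s)"
abbreviation I :: "(nat list \<Rightarrow> 'a) set" where "I \<equiv> clifford_ideal r s"
abbreviation Cl :: "(nat list \<Rightarrow> 'a) set ring" where "Cl \<equiv> clifford r s"

sublocale T: ring T by (rule ring_tensor_algebra)
sublocale I: ideal I T by (rule ideal_clifford_ideal)
sublocale Cl: ring Cl by (rule ring_clifford)

lemmas [simp] = tensor_scalar_closed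

text \<open>The coefficient of e_J in the normal form of a word, defined by the combinatorics of
  words before anything is known about the quotient.\<close>

definition word_coord :: "nat set \<Rightarrow> nat list \<Rightarrow> 'a" where
  "word_coord J w = (if odd_letters w = J then word_sign r w else 0)"

text \<open>Once \<open>u\<close> and \<open>J\<close> are fixed, a nonzero value forces the parity
  set of \<open>v\<close>, so the bicharacter in \<open>word_sign_append\<close> becomes constant in
  \<open>v\<close>.\<close>

lemma word_coord_append_left:
  "\<exists>c. \<forall>v. word_coord J (u @ v) = c * word_coord (sym_diff J (odd_letters u)) v"
proof (intro exI allI)
  fix v
  have "odd_letters (u @ v) = J \<longleftrightarrow> odd_letters v = sym_diff J (odd_letters u)"
    by (auto simp: odd_letters_append)
  then show "word_coord J (u @ v) =
    (word_sign r u * (\<Prod>i\<in>odd_letters u. prod (tau r i) (sym_diff J (odd_letters u)))) *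
    word_coord (sym_diff J (odd_letters u)) v"
    by (simp add: word_coord_def word_sign_append)
qed

lemma word_coord_append_right:
  "\<exists>c. \<forall>u. word_coord J (u @ v) = c * word_coord (sym_diff J (odd_letters v)) u"
proof (intro exI allI)
  fix u
  have "odd_letters (u @ v) = J \<longleftrightarrow> odd_letters u = sym_diff J (odd_letters v)"
    by (auto simp: odd_letters_append)
  then show "word_coord J (u @ v) =
    (word_sign r v * (\<Prod>i\<in>sym_diff J (odd_letters v). prod (tau r i) (odd_letters v))) *
    word_coord (sym_diff J (odd_letters v)) u"
    by (simp add: word_coord_def word_sign_append)
qed

text \<open>Multiplication by a word on either side carries each coordinate functional to a multiple
  of another one, so the common kernel absorbs products.\<close>

lemma ideal_coord_kernel:
  "ideal {t \<in> carrier T. \<forall>J. tensor_eval (word_coord J) t = 0} T" (is "ideal ?K T")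
proof (rule idealI)
  show "subgroup ?K (add_monoid T)"
  proof
    show "inv\<^bsub>add_monoid T\<^esub> t \<in> ?K" if "t \<in> ?K" for t
    proof -
      have "tensor_eval f (\<zero>\<^bsub>T\<^esub> \<ominus>\<^bsub>T\<^esub> t) = - tensor_eval f t" for f
        using that by (subst tensor_eval_minus) simp_all
      then have "\<ominus>\<^bsub>T\<^esub> t \<in> ?K" using that by (simp add: a_minus_def)
      then show ?thesis by (simp only: a_inv_def)
    qed
  qed (auto simp: tensor_eval_add)
  fix t x assume t: "t \<in> ?K" and x: "x \<in> carrier T"
  have "tensor_eval (word_coord J) (x \<otimes>\<^bsub>T\<^esub> t) = 0" for J
  proof -
    have "tensor_eval (\<lambda>v. word_coord J (u @ v)) t = 0" for u
    proof -
      obtain c where "\<And>v. word_coord J (u @ v) = c * word_coord (sym_diff J (odd_letters u)) v"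
        using word_coord_append_left by blast
      then show ?thesis using t by (simp add: tensor_eval_cmult)
    qed
    then show ?thesis using t x by (simp add: tensor_eval_mult)
  qed
  then show "x \<otimes>\<^bsub>T\<^esub> t \<in> ?K" using t x by simp
  have "tensor_eval (word_coord J) (t \<otimes>\<^bsub>T\<^esub> x) = 0" for J
  proof -
    \<comment> \<open>The vanishing hypothesis concerns the left factor, so that factor has to be
      evaluated innermost.\<close>
    have swap: "tensor_eval (\<lambda>u. tensor_eval (\<lambda>v. f u v) x) t = tensor_eval (\<lambda>v. tensor_eval (\<lambda>u. f u v) t) x"
      for f :: "nat list \<Rightarrow> nat list \<Rightarrow> 'a"
      unfolding tensor_eval_def sum_distrib_left
      by (subst sum.swap) (simp add: ac_simps)
    have "tensor_eval (\<lambda>u. word_coord J (u @ v)) t = 0" for v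
    proof -
      obtain c where "\<And>u. word_coord J (u @ v) = c * word_coord (sym_diff J (odd_letters v)) u"
        using word_coord_append_right by blast
      then show ?thesis using t by (simp add: tensor_eval_cmult)
    qed
    then show ?thesis using t x by (simp add: tensor_eval_mult swap)
  qed
  then show "t \<otimes>\<^bsub>T\<^esub> x \<in> ?K" using t x by simp
qed (rule T.ring_axioms)

lemma tensor_eval_tensor_scalar: "tensor_eval f (tensor_scalar a :: _ \<Rightarrow> 'a) = a * f []"
proof -
  have "tensor_scalar (a :: 'a) = tensor_scalar a \<otimes>\<^bsub>T\<^esub> word_tensor []"
    by (simp flip: tensor_one[of "r + s"])
  then show ?thesis by (metis tensor_eval_scalar tensor_eval_word)
qed

text \<open>Twice the coordinate is computed, since the off-diagonal terms of \<open>v \<otimes> v\<close> only cancel in pairs.\<close>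

lemma coord_generator:
  assumes "v \<in> coord_space (r + s)"
  shows "tensor_eval (word_coord J)
    (tensor_vec v \<otimes>\<^bsub>T\<^esub> tensor_vec v \<oplus>\<^bsub>T\<^esub> tensor_scalar (Qform r s v v)) = 0"
proof -
  let ?N = "{1..r + s}" and ?f = "\<lambda>i j. word_coord J [i, j]"
  let ?S = "\<Sum>i\<in>?N. \<Sum>j\<in>?N. v i * v j * ?f i j"
  \<comment> \<open>For distinct \<open>i\<close> and \<open>j\<close> the two words have the same
    parity set and opposite signs.\<close>
  have anti: "?f i j + ?f j i = (if j = i then 2 * ?f i i else 0)" for i j
    by (auto simp: word_coord_def tau_def)
  have "2 * ?S = ?S + (\<Sum>i\<in>?N. \<Sum>j\<in>?N. v j * v i * ?f j i)"
    by (subst (3) sum.swap) simp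
  also have "\<dots> = (\<Sum>i\<in>?N. \<Sum>j\<in>?N. v i * v j * (?f i j + ?f j i))"
    by (simp only: sum.distrib[symmetric]) (simp add: algebra_simps)
  also have "\<dots> = 2 * (\<Sum>i\<in>?N. v i * v i * ?f i i)"
    unfolding anti by (simp add: sum_distrib_left if_distrib[of "times _"] cong: if_cong)
       (simp add: ac_simps)
  finally have "?S = (\<Sum>i\<in>?N. v i * v i * ?f i i)"
    using two_neq_0 by simp
  \<comment> \<open>The words \<open>[i, i]\<close> and \<open>[]\<close> have empty parity set, so
    both sides vanish unless \<open>J = {}\<close>; in that case the diagonal signs of
    \<open>tau\<close> add up to -Q(v, v).\<close>
  also have "\<dots> = - Qform r s v v * word_coord J []"
  proof (cases "J = {}")
    case True
    have "?N = {1..r} \<union> {r + 1..r + s}" by auto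
    then have "(\<Sum>i\<in>?N. v i * v i * ?f i i) =
      (\<Sum>i\<in>{1..r}. v i * v i * ?f i i) + (\<Sum>i\<in>{r + 1..r + s}. v i * v i * ?f i i)"
      by (simp only:) (intro sum.union_disjoint; auto)
    also have "(\<Sum>i\<in>{1..r}. v i * v i * ?f i i) = - (\<Sum>i\<in>{1..r}. v i * v i)"
      unfolding sum_negf[symmetric] by (intro sum.cong) (auto simp: True word_coord_def tau_def)
    also have "(\<Sum>i\<in>{r + 1..r + s}. v i * v i * ?f i i) = (\<Sum>i\<in>{r + 1..r + s}. v i * v i)"
      by (intro sum.cong) (auto simp: True word_coord_def tau_def)
    finally show ?thesis by (simp add: True word_coord_def Qform_def)
  next
    case False
    then show ?thesis by (auto simp: word_coord_def intro!: sum.neutral)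
  qed
  finally show ?thesis using assms
    by (simp add: tensor_eval_add tensor_vec_closed tensor_eval_vec_mult tensor_eval_tensor_scalar)
qed

text \<open>The Clifford ideal is the least one containing its generators, and these lie in the
  common kernel. Hence the functionals descend to the quotient.\<close>

lemma coord_ideal:
  assumes "t \<in> I"
  shows "tensor_eval (word_coord J) t = 0"
proof -
  have "I \<subseteq> {t \<in> carrier T. \<forall>J. tensor_eval (word_coord J) t = 0}"
    unfolding clifford_ideal_def Let_def
    by (intro T.genideal_minimal ideal_coord_kernel) (auto simp: tensor_vec_closed coord_generator)
  then show ?thesis using assms by blast
qed

section \<open>The quotient map and the scalars\<close>

definition proj :: "(nat list \<Rightarrow> 'a) \<Rightarrow> (nat list \<Rightarrow> 'a) set" where
  "proj t = I +>\<^bsub>T\<^esub> t"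

sublocale proj: ring_hom_ring T Cl proj
proof -
  have "proj = (+>\<^bsub>T\<^esub>) I" by (rule ext) (simp add: proj_def)
  then show "ring_hom_ring T Cl proj" unfolding clifford_def by (simp add: I.rcos_ring_hom_ring)
qed

lemma proj_eq_iff:
  assumes "t \<in> carrier T" and "u \<in> carrier T"
  shows "proj t = proj u \<longleftrightarrow> t \<ominus>\<^bsub>T\<^esub> u \<in> I"
  unfolding proj_def using T.quotient_eq_iff_same_a_r_cos[OF I.is_ideal assms] by blast

lemma clifford_cases:
  assumes "x \<in> carrier Cl"
  obtains t where "t \<in> carrier T" and "x = proj t"
  using assms by (auto simp: clifford_def FactRing_def A_RCOSETS_def' proj_def)

definition smult :: "'a \<Rightarrow> (nat list \<Rightarrow> 'a) set \<Rightarrow> (nat list \<Rightarrow> 'a) set" where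
  "smult a x = clifford_scalar r s a \<otimes>\<^bsub>Cl\<^esub> x"

lemma clifford_scalar_eq_proj: "clifford_scalar r s a = proj (tensor_scalar a)"
  by (simp add: clifford_scalar_def proj_def)

lemma clifford_scalar_closed [simp]: "clifford_scalar r s a \<in> carrier Cl"
  by (simp add: clifford_scalar_eq_proj)

lemma smult_closed [simp]: "x \<in> carrier Cl \<Longrightarrow> smult a x \<in> carrier Cl"
  by (simp add: smult_def)

lemma smult_proj: "t \<in> carrier T \<Longrightarrow> smult a (proj t) = proj (tensor_scalar a \<otimes>\<^bsub>T\<^esub> t)"
  by (simp add: smult_def clifford_scalar_eq_proj)

lemma clifford_scalar_mult:
  "clifford_scalar r s a \<otimes>\<^bsub>Cl\<^esub> clifford_scalar r s b = clifford_scalar r s (a * b)"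
proof -
  have "tensor_scalar a \<otimes>\<^bsub>T\<^esub> tensor_scalar b = tensor_scalar (a * b)"
    by (rule ext) (simp add: tensor_scalar_mult, simp add: tensor_scalar_def)
  then show ?thesis by (simp add: clifford_scalar_eq_proj flip: proj.hom_mult)
qed

lemma clifford_scalar_add:
  "clifford_scalar r s a \<oplus>\<^bsub>Cl\<^esub> clifford_scalar r s b = clifford_scalar r s (a + b)"
proof -
  have "tensor_scalar a \<oplus>\<^bsub>T\<^esub> tensor_scalar b = tensor_scalar (a + b)"
    by (rule ext) (simp add: tensor_add tensor_scalar_def)
  then show ?thesis by (simp add: clifford_scalar_eq_proj flip: proj.hom_add)
qed

lemma clifford_scalar_one: "clifford_scalar r s 1 = \<one>\<^bsub>Cl\<^esub>"
  using proj.hom_one by (simp add: clifford_scalar_eq_proj tensor_scalar_one[of "r + s"] )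

lemma clifford_scalar_zero: "clifford_scalar r s 0 = \<zero>\<^bsub>Cl\<^esub>"
proof -
  have "tensor_scalar 0 = \<zero>\<^bsub>T\<^esub>" by (auto simp: tensor_scalar_def tensor_zero)
  then show ?thesis by (simp add: clifford_scalar_eq_proj)
qed

lemma clifford_scalar_commute:
  assumes "x \<in> carrier Cl"
  shows "x \<otimes>\<^bsub>Cl\<^esub> clifford_scalar r s a = clifford_scalar r s a \<otimes>\<^bsub>Cl\<^esub> x"
proof -
  obtain t where "t \<in> carrier T" "x = proj t" using assms by (rule clifford_cases)
  then show ?thesis
    using tensor_scalar_commute[where t = t and n = "r + s" and a = a]
    by (simp add: clifford_scalar_eq_proj flip: proj.hom_mult)
qed

lemma smult_one [simp]: "x \<in> carrier Cl \<Longrightarrow> smult 1 x = x"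
  by (simp add: smult_def clifford_scalar_one)

lemma smult_smult [simp]: "x \<in> carrier Cl \<Longrightarrow> smult a (smult b x) = smult (a * b) x"
  by (simp add: smult_def clifford_scalar_mult flip: Cl.m_assoc)

lemma smult_add_left: "x \<in> carrier Cl \<Longrightarrow> smult (a + b) x = smult a x \<oplus>\<^bsub>Cl\<^esub> smult b x"
  by (simp add: smult_def Cl.l_distr flip: clifford_scalar_add)

lemma smult_zero_left [simp]: "x \<in> carrier Cl \<Longrightarrow> smult 0 x = \<zero>\<^bsub>Cl\<^esub>"
  by (simp add: smult_def clifford_scalar_zero)

lemma smult_minus_one:
  assumes "x \<in> carrier Cl"
  shows "smult (-1) x = \<ominus>\<^bsub>Cl\<^esub> x"
proof -
  have "smult (-1) x \<oplus>\<^bsub>Cl\<^esub> x = \<zero>\<^bsub>Cl\<^esub>"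
    using assms smult_add_left[of x "-1" 1] by simp
  then show ?thesis using assms by (simp add: Cl.minus_equality)
qed

lemma mult_smult_right:
  assumes "x \<in> carrier Cl" and "y \<in> carrier Cl"
  shows "x \<otimes>\<^bsub>Cl\<^esub> smult a y = smult a (x \<otimes>\<^bsub>Cl\<^esub> y)"
proof -
  have "x \<otimes>\<^bsub>Cl\<^esub> smult a y = (x \<otimes>\<^bsub>Cl\<^esub> clifford_scalar r s a) \<otimes>\<^bsub>Cl\<^esub> y"
    using assms by (simp add: smult_def Cl.m_assoc)
  then show ?thesis using assms by (simp add: clifford_scalar_commute smult_def Cl.m_assoc)
qed

lemma mult_smult_left:
  "x \<in> carrier Cl \<Longrightarrow> y \<in> carrier Cl \<Longrightarrow> smult a x \<otimes>\<^bsub>Cl\<^esub> y = smult a (x \<otimes>\<^bsub>Cl\<^esub> y)"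
  by (simp add: smult_def Cl.m_assoc)

section \<open>Words in the Clifford algebra and their normal form\<close>

definition monomial :: "nat list \<Rightarrow> (nat list \<Rightarrow> 'a) set" where
  "monomial w = proj (word_tensor w)"

lemma monomial_closed [simp]: "set w \<subseteq> {1..r + s} \<Longrightarrow> monomial w \<in> carrier Cl"
  by (simp add: monomial_def word_tensor_closed)

lemma monomial_append:
  "set u \<subseteq> {1..r + s} \<Longrightarrow> set v \<subseteq> {1..r + s} \<Longrightarrow>
    monomial (u @ v) = monomial u \<otimes>\<^bsub>Cl\<^esub> monomial v"
  by (simp add: monomial_def word_tensor_closed word_tensor_mult flip: proj.hom_mult)

lemma monomial_Cons:
  "i \<in> {1..r + s} \<Longrightarrow> set w \<subseteq> {1..r + s} \<Longrightarrow>
    monomial (i # w) = monomial [i] \<otimes>\<^bsub>Cl\<^esub> monomial w"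
  using monomial_append[of "[i]" w] by simp

lemma clifford_vec_eq_proj: "clifford_vec r s v = proj (tensor_vec v)"
  by (simp add: clifford_vec_def proj_def)

lemma clifford_vec_square:
  assumes "v \<in> coord_space (r + s)"
  shows "clifford_vec r s v \<otimes>\<^bsub>Cl\<^esub> clifford_vec r s v = clifford_scalar r s (- Qform r s v v)"
proof -
  let ?g = "tensor_vec v \<otimes>\<^bsub>T\<^esub> tensor_vec v \<oplus>\<^bsub>T\<^esub> tensor_scalar (Qform r s v v)"
  have "?g \<in> I" unfolding clifford_ideal_def Let_def
    using assms by (intro subsetD[OF T.genideal_self]) (auto simp: tensor_vec_closed)
  moreover have "?g = tensor_vec v \<otimes>\<^bsub>T\<^esub> tensor_vec v \<ominus>\<^bsub>T\<^esub> tensor_scalar (- Qform r s v v)"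
    by (rule ext) (simp add: tensor_minus tensor_add, simp add: tensor_scalar_def)
  ultimately have "proj (tensor_vec v \<otimes>\<^bsub>T\<^esub> tensor_vec v) = proj (tensor_scalar (- Qform r s v v))"
    using assms by (subst proj_eq_iff) (simp_all add: tensor_vec_closed)
  then show ?thesis
    using assms by (simp add: clifford_vec_eq_proj clifford_scalar_eq_proj tensor_vec_closed)
qed

lemma clifford_vec_basis_vec: "clifford_vec r s (basis_vec i) = monomial [i]"
  by (simp add: clifford_vec_eq_proj monomial_def tensor_vec_basis_vec)

lemma basis_vec_coord_space: "i \<in> {1..n} \<Longrightarrow> basis_vec i \<in> coord_space n"
  by (auto simp: basis_vec_def coord_space_def)

text \<open>The convention v v = -Q(v, v) is what makes the diagonal of \<open>tau\<close> negative
  exactly for the indices up to \<open>r\<close>.\<close>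

lemma monomial_square:
  assumes "i \<in> {1..r + s}"
  shows "monomial [i] \<otimes>\<^bsub>Cl\<^esub> monomial [i] = clifford_scalar r s (tau r i i)"
  using clifford_vec_square[OF basis_vec_coord_space[OF assms]] assms
  by (simp only: clifford_vec_basis_vec Qform_basis_vec) (simp add: tau_def)

text \<open>Polarization: expand the square of e_i + e_j, on which Q is additive by
  orthogonality.\<close>

lemma monomial_anticommute:
  assumes i: "i \<in> {1..r + s}" and j: "j \<in> {1..r + s}" and "i \<noteq> j"
  shows "monomial [i] \<otimes>\<^bsub>Cl\<^esub> monomial [j] = smult (-1) (monomial [j] \<otimes>\<^bsub>Cl\<^esub> monomial [i])"
proof -
  let ?v = "\<lambda>k. basis_vec i k + basis_vec j k :: 'a"
  let ?x = "monomial [i]" and ?y = "monomial [j]"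
  have v: "?v \<in> coord_space (r + s)"
    using i j by (auto simp: basis_vec_def coord_space_def)
  have [simp]: "?x \<in> carrier Cl" "?y \<in> carrier Cl" using i j by auto
  have "tensor_vec ?v = tensor_vec (basis_vec i) \<oplus>\<^bsub>T\<^esub> tensor_vec (basis_vec j)"
    by (auto simp: tensor_vec_def tensor_add split: list.splits)
  then have vec: "clifford_vec r s ?v = ?x \<oplus>\<^bsub>Cl\<^esub> ?y"
    using i j by (simp add: clifford_vec_eq_proj tensor_vec_basis_vec monomial_def word_tensor_closed)
  have "Qform r s ?v ?v = Qform r s (basis_vec i) (basis_vec i) + Qform r s (basis_vec j) (basis_vec j)
      + (Qform r s (basis_vec i) (basis_vec j) + Qform r s (basis_vec j) (basis_vec i))"
  proof -
    have "(a + b) * (a + b) = a * a + b * b + (a * b + b * a)" for a b :: 'a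
      by (simp add: algebra_simps)
    then show ?thesis by (simp only: Qform_def sum.distrib) (simp add: algebra_simps)
  qed
  also have "\<dots> = - tau r i i - tau r j j"
    using i j \<open>i \<noteq> j\<close> by (simp only: Qform_basis_vec) (simp add: tau_def)
  finally have "(?x \<oplus>\<^bsub>Cl\<^esub> ?y) \<otimes>\<^bsub>Cl\<^esub> (?x \<oplus>\<^bsub>Cl\<^esub> ?y) =
      ?x \<otimes>\<^bsub>Cl\<^esub> ?x \<oplus>\<^bsub>Cl\<^esub> ?y \<otimes>\<^bsub>Cl\<^esub> ?y"
    using clifford_vec_square[OF v] i j by (simp add: vec monomial_square clifford_scalar_add add.commute)
  moreover have "(?x \<oplus>\<^bsub>Cl\<^esub> ?y) \<otimes>\<^bsub>Cl\<^esub> (?x \<oplus>\<^bsub>Cl\<^esub> ?y) =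
      (?x \<otimes>\<^bsub>Cl\<^esub> ?x \<oplus>\<^bsub>Cl\<^esub> ?y \<otimes>\<^bsub>Cl\<^esub> ?y) \<oplus>\<^bsub>Cl\<^esub>
      (?x \<otimes>\<^bsub>Cl\<^esub> ?y \<oplus>\<^bsub>Cl\<^esub> ?y \<otimes>\<^bsub>Cl\<^esub> ?x)"
    by (simp add: Cl.l_distr Cl.r_distr Cl.add.m_ac)
  ultimately have "?x \<otimes>\<^bsub>Cl\<^esub> ?y \<oplus>\<^bsub>Cl\<^esub> ?y \<otimes>\<^bsub>Cl\<^esub> ?x = \<zero>\<^bsub>Cl\<^esub>"
    by (simp add: Cl.add.r_cancel_one')
  then show ?thesis by (simp add: smult_minus_one Cl.minus_equality)
qed

text \<open>One step of insertion sort. Against the smallest letter \<open>x\<close>, the new letter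
  \<open>i\<close> stays in front, merges with \<open>x\<close> into a scalar, or passes
  \<open>x\<close> with a sign and is inserted further on.\<close>

lemma monomial_insert:
  assumes "sorted_wrt (<) xs" and "set xs \<subseteq> {1..r + s}" and "i \<in> {1..r + s}"
  shows "\<exists>ys. sorted_wrt (<) ys \<and> set ys = sym_diff {i} (set xs) \<and>
    monomial (i # xs) = smult (prod (tau r i) (set xs)) (monomial ys)"
  using assms(1,2)
proof (induction xs)
  case Nil
  then show ?case using assms(3) by (intro exI[of _ "[i]"]) simp
next
  case (Cons x xs)
  have x: "x \<in> {1..r + s}" and xs: "set xs \<subseteq> {1..r + s}" and gt: "\<forall>y\<in>set xs. x < y"
    and sorted: "sorted_wrt (<) xs"
    using Cons.prems by auto
  have tau_prod: "prod (tau r i) (set (x # xs)) = tau r i x * (prod (tau r i) (set xs) :: 'a)"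
    using gt by (subst list.set, subst prod.insert) auto
  note [simp] = monomial_square monomial_Cons[of _ "_ # _"]
  consider "i < x" | "i = x" | "x < i" by linarith
  then show ?case
  proof cases
    case 1
    then have "prod (tau r i) (set (x # xs)) = (1 :: 'a)"
      using gt by (intro prod.neutral) (auto simp: tau_def)
    moreover have "set (i # x # xs) = sym_diff {i} (set (x # xs))" "sorted_wrt (<) (i # x # xs)"
      using 1 gt sorted by auto
    moreover have "monomial (i # x # xs) \<in> carrier Cl" using assms(3) Cons.prems by simp
    ultimately show ?thesis by (intro exI[of _ "i # x # xs"]) (simp only: smult_one simp_thms)
  next
    case 2
    \<comment> \<open>All later letters exceed \<open>i\<close>, so only the factor e_i^2
      remains.\<close>
    have "prod (tau r i) (set xs) = (1 :: 'a)"
      using gt 2 by (intro prod.neutral) (auto simp: tau_def)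
    then have eq: "prod (tau r i) (set (x # xs)) = (tau r i i :: 'a)"
      unfolding tau_prod using 2 by simp
    have "monomial (i # x # xs) = smult (prod (tau r i) (set (x # xs))) (monomial xs)"
      unfolding eq
      using 2 x xs by (simp add: monomial_Cons[of x xs] smult_def flip: Cl.m_assoc)
    moreover have "set xs = sym_diff {i} (set (x # xs))" using 2 gt by auto
    ultimately show ?thesis using sorted by blast
  next
    case 3
    obtain ys where ys: "sorted_wrt (<) ys" "set ys = sym_diff {i} (set xs)"
      "monomial (i # xs) = smult (prod (tau r i) (set xs)) (monomial ys)"
      using Cons.IH sorted xs by blast
    have sub: "set ys \<subseteq> {1..r + s}" using ys(2) xs assms(3) by auto
    have "monomial (i # x # xs) = (monomial [i] \<otimes>\<^bsub>Cl\<^esub> monomial [x]) \<otimes>\<^bsub>Cl\<^esub> monomial xs"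
      using assms(3) x xs by (simp add: monomial_Cons[of x xs] Cl.m_assoc)
    also have "\<dots> = smult (-1) (monomial [x] \<otimes>\<^bsub>Cl\<^esub> monomial (i # xs))"
      using assms(3) x xs 3
      by (simp add: monomial_anticommute[of i x] mult_smult_left monomial_Cons[of i xs] Cl.m_assoc)
    also have "\<dots> = smult (- prod (tau r i) (set xs)) (monomial (x # ys))"
      using x sub by (simp add: ys(3) mult_smult_right monomial_Cons[of x ys])
    also have "- prod (tau r i) (set xs) = (prod (tau r i) (set (x # xs)) :: 'a)"
      using 3 unfolding tau_prod by (simp add: tau_def)
    finally have "monomial (i # x # xs) = smult (prod (tau r i) (set (x # xs))) (monomial (x # ys))" .
    moreover have "sorted_wrt (<) (x # ys)" using ys(1,2) 3 gt by auto
    moreover have "set (x # ys) = sym_diff {i} (set (x # xs))" using ys(2) 3 gt by auto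
    ultimately show ?thesis by blast
  qed
qed

text \<open>Sort the tail first, then insert the head; the signs multiply as in the recursion of
  \<open>word_sign\<close>. So the sorted products span the algebra.\<close>

lemma monomial_normal_form:
  assumes "set w \<subseteq> {1..r + s}"
  shows "\<exists>ys. sorted_wrt (<) ys \<and> set ys = odd_letters w \<and>
    monomial w = smult (word_sign r w) (monomial ys)"
  using assms
proof (induction w)
  case Nil
  then show ?case by (intro exI[of _ "[]"]) simp
next
  case (Cons i w)
  then have i: "i \<in> {1..r + s}" and w: "set w \<subseteq> {1..r + s}" by auto
  obtain xs where xs: "sorted_wrt (<) xs" "set xs = odd_letters w"
    "monomial w = smult (word_sign r w) (monomial xs)"
    using Cons.IH w by blast
  have sub: "set xs \<subseteq> {1..r + s}" using xs(2) odd_letters_subset w by blast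
  obtain ys where ys: "sorted_wrt (<) ys" "set ys = sym_diff {i} (set xs)"
    "monomial (i # xs) = smult (prod (tau r i) (set xs)) (monomial ys)"
    using monomial_insert[OF xs(1) sub i] by blast
  have sub': "set ys \<subseteq> {1..r + s}" using ys(2) sub i by auto
  have "monomial (i # w) = smult (word_sign r w) (monomial (i # xs))"
    using i w sub by (simp add: monomial_Cons[of i w] monomial_Cons[of i xs] xs(3) mult_smult_right)
  also have "\<dots> = smult (word_sign r (i # w)) (monomial ys)"
    using sub' by (simp add: ys(3) xs(2) mult.commute)
  finally have "monomial (i # w) = smult (word_sign r (i # w)) (monomial ys)" .
  moreover have "set ys = odd_letters (i # w)" unfolding ys(2) xs(2) by simp
  ultimately show ?case using ys(1) by blast
qed

section \<open>Coordinates determine an element\<close>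

definition sorted_part :: "(nat list \<Rightarrow> 'a) \<Rightarrow> nat list \<Rightarrow> 'a" where
  "sorted_part t w =
    (if sorted_wrt (<) w \<and> set w \<subseteq> {1..r + s} then tensor_eval (word_coord (set w)) t else 0)"

lemma sorted_part_closed: "sorted_part t \<in> carrier T"
proof -
  \<comment> \<open>A strictly increasing word is recovered from its set of letters, so only
    finitely many words can occur.\<close>
  have "{w. sorted_part t w \<noteq> 0} \<subseteq> sorted_list_of_set ` Pow {1..r + s}"
  proof
    fix w assume "w \<in> {w. sorted_part t w \<noteq> 0}"
    then have "sorted_wrt (<) w" "set w \<in> Pow {1..r + s}"
      by (auto simp: sorted_part_def split: if_splits)
    moreover from this(1) have "w = sorted_list_of_set (set w)"
      by (simp add: strict_sorted_iff sorted_list_of_set.idem_if_sorted_distinct)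
    ultimately show "w \<in> sorted_list_of_set ` Pow {1..r + s}" by blast
  qed
  then have "finite {w. sorted_part t w \<noteq> 0}" by (rule finite_subset) simp
  then show ?thesis by (auto simp: tensor_algebra_def sorted_part_def split: if_splits)
qed

text \<open>Both sides are linear in \<open>t\<close>, and for a single word the claim is its normal
  form. Every class thus has a representative read off from coordinates.\<close>

lemma proj_sorted_part:
  assumes "t \<in> carrier T"
  shows "proj (sorted_part t) = proj t"
  using assms
proof (induction t rule: tensor_induct)
  case zero
  have "sorted_part \<zero>\<^bsub>T\<^esub> = \<zero>\<^bsub>T\<^esub>"
    by (rule ext) (simp add: sorted_part_def, simp add: tensor_zero)
  then show ?case by simp
next
  case (add t a w)
  obtain ys where ys: "sorted_wrt (<) ys" "set ys = odd_letters w"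
    "monomial w = smult (word_sign r w) (monomial ys)"
    using monomial_normal_form add.hyps by blast
  have sub: "set ys \<subseteq> {1..r + s}" using ys(2) odd_letters_subset add.hyps by blast
  have word: "word_tensor w \<in> carrier T" using add.hyps by (simp add: word_tensor_closed)
  \<comment> \<open>Only one increasing word has the parity set of \<open>w\<close> as its set of
    letters, namely \<open>ys\<close>.\<close>
  have "sorted_part (word_tensor w) = tensor_scalar (word_sign r w) \<otimes>\<^bsub>T\<^esub> word_tensor ys"
  proof
    fix v
    show "sorted_part (word_tensor w) v =
        (tensor_scalar (word_sign r w) \<otimes>\<^bsub>T\<^esub> word_tensor ys) v"
    proof (cases "v = ys")
      case True
      show ?thesis
        unfolding tensor_scalar_mult True using ys(1) sub
        by (simp add: sorted_part_def word_tensor_def[of ys] word_coord_def ys(2)[symmetric])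
    next
      case False
      then have "odd_letters w \<noteq> set v" if "sorted_wrt (<) v"
        using ys(1,2) that strict_sorted_equal by blast
      then show ?thesis
        unfolding tensor_scalar_mult using False
        by (simp add: sorted_part_def word_tensor_def[of ys] word_coord_def)
    qed
  qed
  then have "proj (sorted_part (word_tensor w)) = proj (word_tensor w)"
    using ys(3) sub by (simp add: monomial_def smult_proj word_tensor_closed)
  moreover have "sorted_part (t \<oplus>\<^bsub>T\<^esub> tensor_scalar a \<otimes>\<^bsub>T\<^esub> word_tensor w) =
      sorted_part t \<oplus>\<^bsub>T\<^esub> tensor_scalar a \<otimes>\<^bsub>T\<^esub> sorted_part (word_tensor w)"
    unfolding tensor_add[where t = "sorted_part t"]
      tensor_scalar_mult[where t = "sorted_part (word_tensor w)"]
    using add.hyps word by (intro ext) (simp add: sorted_part_def tensor_eval_add tensor_eval_scalar)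
  ultimately show ?case
    using add word sorted_part_closed by simp
qed

text \<open>Choosing a representative is harmless: two of them differ by an element of the ideal,
  where \<open>coord_ideal\<close> applies.\<close>

definition coord :: "nat set \<Rightarrow> (nat list \<Rightarrow> 'a) set \<Rightarrow> 'a" where
  "coord J x = tensor_eval (word_coord J) (SOME t. t \<in> carrier T \<and> proj t = x)"

lemma coord_proj [simp]:
  assumes "t \<in> carrier T"
  shows "coord J (proj t) = tensor_eval (word_coord J) t"
proof -
  define u where "u = (SOME u. u \<in> carrier T \<and> proj u = proj t)"
  have u: "u \<in> carrier T" "proj u = proj t"
    using someI[of "\<lambda>u. u \<in> carrier T \<and> proj u = proj t" t] assms unfolding u_def by auto
  then have "tensor_eval (word_coord J) (u \<ominus>\<^bsub>T\<^esub> t) = 0"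
    using proj_eq_iff assms by (intro coord_ideal) simp
  then show ?thesis using u assms by (simp add: coord_def u_def[symmetric] tensor_eval_minus)
qed

lemma coord_add:
  "x \<in> carrier Cl \<Longrightarrow> y \<in> carrier Cl \<Longrightarrow> coord J (x \<oplus>\<^bsub>Cl\<^esub> y) = coord J x + coord J y"
  by (elim clifford_cases) (simp add: tensor_eval_add flip: proj.hom_add)

lemma coord_smult: "x \<in> carrier Cl \<Longrightarrow> coord J (smult a x) = a * coord J x"
  by (elim clifford_cases) (simp add: smult_proj tensor_eval_scalar del: proj.hom_mult)

lemma coord_uminus: "x \<in> carrier Cl \<Longrightarrow> coord J (\<ominus>\<^bsub>Cl\<^esub> x) = - coord J x"
  by (simp add: coord_smult flip: smult_minus_one)

lemma coord_zero [simp]: "coord J \<zero>\<^bsub>Cl\<^esub> = 0"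
  by (simp flip: proj.hom_zero)

lemma coord_monomial: "set w \<subseteq> {1..r + s} \<Longrightarrow> coord J (monomial w) = word_coord J w"
  by (simp add: monomial_def word_tensor_closed)

text \<open>The index of a coordinate ranges over all sets of naturals, but letters outside the
  range occur in no representative.\<close>

lemma coord_outside:
  assumes "x \<in> carrier Cl" and "\<not> J \<subseteq> {1..r + s}"
  shows "coord J x = 0"
proof -
  obtain t where t: "t \<in> carrier T" "x = proj t" using assms(1) by (rule clifford_cases)
  have "word_coord J w = 0" if "t w \<noteq> 0" for w
  proof -
    have "set w \<subseteq> {1..r + s}" using t(1) that by (simp add: tensor_algebra_def)
    then have "odd_letters w \<noteq> J" using assms(2) odd_letters_subset[of w] by blast
    then show ?thesis by (simp add: word_coord_def)
  qed
  then show ?thesis using t by (auto simp: tensor_eval_def intro!: sum.neutral)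
qed

text \<open>The sorted part is built from the coordinates alone and still represents the
  element.\<close>

lemma coord_eqI:
  assumes "x \<in> carrier Cl" and "y \<in> carrier Cl" and "\<And>J. coord J x = coord J y"
  shows "x = y"
proof -
  obtain t u where t: "t \<in> carrier T" "x = proj t" and u: "u \<in> carrier T" "y = proj u"
    using assms(1,2) by (meson clifford_cases)
  then have "sorted_part t = sorted_part u"
    using assms(3) by (auto simp: sorted_part_def)
  then show ?thesis using t u by (metis proj_sorted_part)
qed

subsection \<open>Dimensions of coordinate subspaces\<close>

lemma subfield_clifford_scalars: "subfield (clifford_scalars r s) Cl"
proof (rule Cl.subfieldI)
  let ?F = "clifford_scalars r s :: (nat list \<Rightarrow> 'a) set set"
  \<comment> \<open>The algebra is nonzero because the coordinate at the empty set takes the value 1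
    on the empty product.\<close>
  have one_neq_zero: "\<one>\<^bsub>Cl\<^esub> \<noteq> \<zero>\<^bsub>Cl\<^esub>"
  proof
    assume "\<one>\<^bsub>Cl\<^esub> = \<zero>\<^bsub>Cl\<^esub>"
    moreover have "\<one>\<^bsub>Cl\<^esub> = monomial []"
      by (simp add: monomial_def flip: tensor_one[of "r + s"])
    ultimately have "coord {} (monomial []) = 0" by simp
    then show False by (simp add: coord_monomial word_coord_def)
  qed
  have scalar_minus: "\<ominus>\<^bsub>Cl\<^esub> clifford_scalar r s a = clifford_scalar r s (- a)" for a :: 'a
    by (intro Cl.minus_equality) (simp_all add: clifford_scalar_add clifford_scalar_zero)
  have F: "?F \<subseteq> carrier Cl" by (auto simp: clifford_scalars_def)
  show "subcring ?F Cl"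
  proof (intro Cl.subcringI Cl.subringI)
    show "\<one>\<^bsub>Cl\<^esub> \<in> ?F" unfolding clifford_scalars_def clifford_scalar_one[symmetric] by blast
  qed (use F in \<open>auto simp: clifford_scalars_def scalar_minus clifford_scalar_add clifford_scalar_mult mult.commute\<close>)
  show "Units (Cl\<lparr>carrier := ?F\<rparr>) = ?F - {\<zero>\<^bsub>Cl\<^esub>}"
  proof (intro equalityI subsetI)
    fix x assume x: "x \<in> Units (Cl\<lparr>carrier := ?F\<rparr>)"
    then obtain y where y: "x \<in> ?F" "y \<in> ?F" "y \<otimes>\<^bsub>Cl\<^esub> x = \<one>\<^bsub>Cl\<^esub>"
      by (auto simp: Units_def)
    moreover from y have "x \<noteq> \<zero>\<^bsub>Cl\<^esub>" using one_neq_zero F by auto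
    ultimately show "x \<in> ?F - {\<zero>\<^bsub>Cl\<^esub>}" by simp
  next
    fix x assume x: "x \<in> ?F - {\<zero>\<^bsub>Cl\<^esub>}"
    then obtain a where a: "x = clifford_scalar r s a" by (auto simp: clifford_scalars_def)
    then have "a \<noteq> 0" using x clifford_scalar_zero by auto
    then have "clifford_scalar r s (inverse a) \<otimes>\<^bsub>Cl\<^esub> x = \<one>\<^bsub>Cl\<^esub>"
      "x \<otimes>\<^bsub>Cl\<^esub> clifford_scalar r s (inverse a) = \<one>\<^bsub>Cl\<^esub>"
      by (simp_all add: a clifford_scalar_mult clifford_scalar_one)
    moreover have "clifford_scalar r s (inverse a) \<in> ?F" by (simp add: clifford_scalars_def)
    ultimately show "x \<in> Units (Cl\<lparr>carrier := ?F\<rparr>)" using x by (auto simp: Units_def)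
  qed
qed

text \<open>For \<open>S\<close> inside \<open>Pow {1..r + s}\<close> this is the span of the e_J
  with \<open>J \<in> S\<close>, cut out by equations instead of generators.\<close>

definition coord_subspace :: "nat set set \<Rightarrow> (nat list \<Rightarrow> 'a) set set" where
  "coord_subspace S = {x \<in> carrier Cl. \<forall>J. J \<notin> S \<longrightarrow> coord J x = 0}"

lemma coord_sorted_monomial:
  assumes "J \<subseteq> {1..r + s}"
  shows "coord K (monomial (sorted_list_of_set J)) = (if K = J then 1 else 0)"
proof -
  have "finite J" using assms finite_subset by blast
  then show ?thesis
    using assms odd_letters_distinct[of "sorted_list_of_set J"]
    by (auto simp: coord_monomial word_coord_def word_sign_sorted)
qed

text \<open>Subtracting the e_J-component of an element leaves one whose coordinate at
  \<open>J\<close> is zero, so a new index adjoins a line.\<close>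

lemma coord_subspace_insert:
  assumes J: "J \<subseteq> {1..r + s}"
  shows "coord_subspace (insert J S) =
    Cl.line_extension (clifford_scalars r s) (monomial (sorted_list_of_set J)) (coord_subspace S)"
    (is "_ = Cl.line_extension ?F ?e _")
proof -
  have "finite J" using J finite_subset by blast
  then have e: "?e \<in> carrier Cl" using J by simp
  note coord_e = coord_sorted_monomial[OF J]
  show ?thesis
  proof (intro equalityI subsetI)
    fix x assume x: "x \<in> coord_subspace (insert J S)"
    let ?y = "x \<oplus>\<^bsub>Cl\<^esub> smult (- coord J x) ?e"
    have "?y \<in> coord_subspace S"
      using x e by (auto simp: coord_subspace_def coord_add coord_smult coord_e)
    moreover have "x = clifford_scalar r s (coord J x) \<otimes>\<^bsub>Cl\<^esub> ?e \<oplus>\<^bsub>Cl\<^esub> ?y"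
      unfolding smult_def[symmetric] using x e
      by (intro coord_eqI) (auto simp: coord_subspace_def coord_add coord_smult)
    ultimately show "x \<in> Cl.line_extension ?F ?e (coord_subspace S)"
      unfolding Cl.line_extension_mem_iff clifford_scalars_def by blast
  next
    fix x assume "x \<in> Cl.line_extension ?F ?e (coord_subspace S)"
    then obtain a y where "y \<in> coord_subspace S" "x = smult a ?e \<oplus>\<^bsub>Cl\<^esub> y"
      unfolding Cl.line_extension_mem_iff clifford_scalars_def smult_def by blast
    then show "x \<in> coord_subspace (insert J S)"
      using e by (auto simp: coord_subspace_def coord_add coord_smult coord_e)
  qed
qed

lemma dimension_coord_subspace:
  assumes "finite S" and "S \<subseteq> Pow {1..r + s}"
  shows "Cl.dimension (card S) (clifford_scalars r s) (coord_subspace S)"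
  using assms
proof (induction S rule: finite_induct)
  case empty
  have "coord_subspace {} = {\<zero>\<^bsub>Cl\<^esub>}"
  proof (intro equalityI subsetI)
    fix x assume "x \<in> coord_subspace {}"
    then have "x = \<zero>\<^bsub>Cl\<^esub>" by (intro coord_eqI) (simp_all add: coord_subspace_def)
    then show "x \<in> {\<zero>\<^bsub>Cl\<^esub>}" by simp
  qed (simp add: coord_subspace_def)
  then show ?case by simp
next
  case (insert J S)
  have J: "J \<subseteq> {1..r + s}" using insert.prems by simp
  then have "finite J" using finite_subset by blast
  \<comment> \<open>The new vector has coordinate 1 at \<open>J\<close>, an index outside
    \<open>S\<close>; so the dimension goes up by one.\<close>
  have "monomial (sorted_list_of_set J) \<notin> coord_subspace S"
    using insert.hyps J by (auto simp: coord_subspace_def coord_sorted_monomial)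
  then show ?case
    unfolding coord_subspace_insert[OF J] card_insert_disjoint[OF insert.hyps(1,2)]
    using insert.prems insert.IH J \<open>finite J\<close> by (intro Cl.Suc_dim) auto
qed

subsection \<open>The conjugation\<close>

text \<open>Restriction to the carrier makes the map extensional, as the description in
  \<open>clifford_conj\<close> demands. The choice of representative is justified by
  \<open>conj_rev_proj\<close>.\<close>

definition conj_rev :: "(nat list \<Rightarrow> 'a) set \<Rightarrow> (nat list \<Rightarrow> 'a) set" where
  "conj_rev = restrict (\<lambda>x. proj (tensor_rev (SOME t. t \<in> carrier T \<and> proj t = x))) (carrier Cl)"

text \<open>Signed reversal acts diagonally on coordinates by \<open>word_sign_rev\<close>, with an
  eigenvalue that depends only on the size of \<open>J\<close>.\<close>

lemma coord_tensor_rev: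
  "tensor_eval (word_coord J) (tensor_rev t) = rev_sign (card J) * tensor_eval (word_coord J) t"
proof -
  have "(-1) ^ length w * word_coord J (rev w) = rev_sign (card J) * word_coord J w" for w
    by (simp add: word_coord_def word_sign_rev)
  then show ?thesis by (simp add: tensor_eval_rev tensor_eval_cmult)
qed

text \<open>Representatives of one class have equal coordinates, hence so do their reversals, and
  coordinates separate the classes.\<close>

lemma conj_rev_proj:
  assumes "t \<in> carrier T"
  shows "conj_rev (proj t) = proj (tensor_rev t)"
proof -
  define u where "u = (SOME u. u \<in> carrier T \<and> proj u = proj t)"
  have u: "u \<in> carrier T" "proj u = proj t"
    using someI[of "\<lambda>u. u \<in> carrier T \<and> proj u = proj t" t] assms unfolding u_def by auto
  have "proj (tensor_rev u) = proj (tensor_rev t)"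
  proof (rule coord_eqI)
    show "coord J (proj (tensor_rev u)) = coord J (proj (tensor_rev t))" for J
      using u assms coord_proj[OF u(1), of J] coord_proj[OF assms, of J]
      by (simp add: tensor_rev_closed coord_tensor_rev)
  qed (simp_all add: u assms tensor_rev_closed)
  then show ?thesis using assms by (simp add: conj_rev_def u_def)
qed

lemma coord_conj_rev:
  "x \<in> carrier Cl \<Longrightarrow> coord J (conj_rev x) = rev_sign (card J) * coord J x"
  by (elim clifford_cases) (simp add: conj_rev_proj tensor_rev_closed coord_tensor_rev)

lemma conj_rev_closed: "x \<in> carrier Cl \<Longrightarrow> conj_rev x \<in> carrier Cl"
  by (elim clifford_cases) (simp add: conj_rev_proj tensor_rev_closed)

lemma conj_rev_conj_rev: "x \<in> carrier Cl \<Longrightarrow> conj_rev (conj_rev x) = x"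
  by (elim clifford_cases) (simp add: conj_rev_proj tensor_rev_closed)

lemma conj_rev_mult:
  assumes "x \<in> carrier Cl" and "y \<in> carrier Cl"
  shows "conj_rev (x \<otimes>\<^bsub>Cl\<^esub> y) = conj_rev y \<otimes>\<^bsub>Cl\<^esub> conj_rev x"
proof -
  obtain t u where "t \<in> carrier T" "x = proj t" "u \<in> carrier T" "y = proj u"
    using assms by (meson clifford_cases)
  then show ?thesis
    using conj_rev_proj[of "t \<otimes>\<^bsub>T\<^esub> u"]
    by (simp add: conj_rev_proj tensor_rev_closed tensor_rev_mult)
qed

lemma conj_rev_add:
  assumes "x \<in> carrier Cl" and "y \<in> carrier Cl"
  shows "conj_rev (x \<oplus>\<^bsub>Cl\<^esub> y) = conj_rev x \<oplus>\<^bsub>Cl\<^esub> conj_rev y"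
proof -
  obtain t u where "t \<in> carrier T" "x = proj t" "u \<in> carrier T" "y = proj u"
    using assms by (meson clifford_cases)
  then show ?thesis
    using conj_rev_proj[of "t \<oplus>\<^bsub>T\<^esub> u"]
    by (simp add: conj_rev_proj tensor_rev_closed tensor_rev_add)
qed

lemma conj_rev_scalar: "conj_rev (clifford_scalar r s a) = clifford_scalar r s a"
  by (simp add: clifford_scalar_eq_proj conj_rev_proj)

lemma conj_rev_vec:
  "v \<in> coord_space (r + s) \<Longrightarrow> conj_rev (clifford_vec r s v) = \<ominus>\<^bsub>Cl\<^esub> clifford_vec r s v"
  by (simp add: clifford_vec_eq_proj conj_rev_proj tensor_vec_closed tensor_rev_vec)

lemma clifford_anti_automorphism_conj_rev: "clifford_anti_automorphism r s conj_rev"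
  unfolding clifford_anti_automorphism_def
proof (intro conjI allI ballI)
  have "conj_rev \<in> ring_hom Cl (opposite_ring Cl)"
    using conj_rev_scalar[of 1]
    by (intro ring_hom_memI)
      (simp_all add: opposite_ring_def conj_rev_closed conj_rev_mult conj_rev_add clifford_scalar_one)
  moreover have "bij_betw conj_rev (carrier Cl) (carrier (opposite_ring Cl))"
    by (rule bij_betwI[where g = conj_rev])
      (auto simp: opposite_ring_def conj_rev_closed conj_rev_conj_rev)
  ultimately show "conj_rev \<in> ring_iso Cl (opposite_ring Cl)" by (simp add: ring_iso_def)
  fix a and x assume "x \<in> carrier Cl"
  then show "conj_rev (clifford_scalar r s a \<otimes>\<^bsub>Cl\<^esub> x) = clifford_scalar r s a \<otimes>\<^bsub>Cl\<^esub> conj_rev x"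
    by (simp add: conj_rev_mult conj_rev_scalar clifford_scalar_commute conj_rev_closed)
qed

text \<open>The values on the e_i determine those on words by multiplicativity, and then all values
  by linearity.\<close>

lemma clifford_anti_automorphism_unique:
  assumes c: "clifford_anti_automorphism r s c"
    and vec: "\<And>v. v \<in> coord_space (r + s) \<Longrightarrow> c (clifford_vec r s v) = \<ominus>\<^bsub>Cl\<^esub> clifford_vec r s v"
    and x: "x \<in> carrier Cl"
  shows "c x = conj_rev x"
proof -
  have "c \<in> ring_hom Cl (opposite_ring Cl)"
    using c by (simp add: clifford_anti_automorphism_def ring_iso_def)
  note hom = ring_hom_memE[OF this, unfolded opposite_ring_def, simplified]
  have smult: "c (smult a y) = smult a (c y)" if "y \<in> carrier Cl" for a y
    using c that by (simp add: clifford_anti_automorphism_def smult_def)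
  have word: "c (monomial w) = conj_rev (monomial w)" if "set w \<subseteq> {1..r + s}" for w
    using that
  proof (induction w)
    case Nil
    have "monomial [] = \<one>\<^bsub>Cl\<^esub>"
      by (simp add: monomial_def flip: tensor_one[of "r + s"])
    then show ?case using hom(4) conj_rev_scalar[of 1] by (simp add: clifford_scalar_one)
  next
    case (Cons i w)
    then have i: "i \<in> {1..r + s}" and w: "set w \<subseteq> {1..r + s}" by auto
    then have "c (monomial [i]) = conj_rev (monomial [i])"
      using vec[OF basis_vec_coord_space[OF i]] conj_rev_vec[OF basis_vec_coord_space[OF i]]
      by (simp add: clifford_vec_basis_vec)
    then show ?case
      using i w Cons.IH[OF w] by (simp add: monomial_Cons[of i w] hom(2) conj_rev_mult)
  qed
  obtain t where t: "t \<in> carrier T" "x = proj t" using x by (rule clifford_cases)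
  have "c (proj t) = conj_rev (proj t)"
    using t(1)
  proof (induction t rule: tensor_induct)
    case zero
    \<comment> \<open>The image of zero comes from linearity with the scalar 0.\<close>
    have zero: "c \<zero>\<^bsub>Cl\<^esub> = \<zero>\<^bsub>Cl\<^esub>"
      using smult[of "\<zero>\<^bsub>Cl\<^esub>" 0] hom(1)[of "\<zero>\<^bsub>Cl\<^esub>"] by simp
    have "conj_rev \<zero>\<^bsub>Cl\<^esub> = \<zero>\<^bsub>Cl\<^esub>"
      by (intro coord_eqI) (simp_all add: conj_rev_closed coord_conj_rev)
    then show ?case using zero by simp
  next
    case (add t a w)
    have m: "monomial w \<in> carrier Cl" using add.hyps by simp
    have eq: "proj (t \<oplus>\<^bsub>T\<^esub> tensor_scalar a \<otimes>\<^bsub>T\<^esub> word_tensor w) = proj t \<oplus>\<^bsub>Cl\<^esub> smult a (monomial w)"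
      using add.hyps by (simp add: monomial_def smult_proj word_tensor_closed del: proj.hom_mult)
    have "conj_rev (smult a (monomial w)) = smult a (conj_rev (monomial w))"
      using m by (simp add: smult_def conj_rev_mult conj_rev_scalar clifford_scalar_commute conj_rev_closed)
    then show ?case
      unfolding eq using add m by (simp add: hom(3) conj_rev_add smult word)
  qed
  then show ?thesis using t(2) by simp
qed

lemma clifford_conj_eq: "clifford_conj r s = conj_rev"
  unfolding clifford_conj_def
proof (rule the_equality)
  show "conj_rev \<in> extensional (carrier Cl) \<and> clifford_anti_automorphism r s conj_rev \<and>
    (\<forall>v\<in>coord_space (r + s). conj_rev (clifford_vec r s v) = \<ominus>\<^bsub>Cl\<^esub> clifford_vec r s v)"
    using clifford_anti_automorphism_conj_rev conj_rev_vec by (simp add: conj_rev_def)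
next
  fix c
  assume c: "c \<in> extensional (carrier Cl) \<and> clifford_anti_automorphism r s c \<and>
    (\<forall>v\<in>coord_space (r + s). c (clifford_vec r s v) = \<ominus>\<^bsub>Cl\<^esub> clifford_vec r s v)"
  show "c = conj_rev"
  proof (rule extensionalityI)
    show "c \<in> extensional (carrier Cl)" using c by blast
    show "conj_rev \<in> extensional (carrier Cl)" by (simp add: conj_rev_def)
    show "c x = conj_rev x" if "x \<in> carrier Cl" for x
      using c that by (intro clifford_anti_automorphism_unique) auto
  qed
qed

text \<open>Anti-invariance is read coordinate by coordinate: an eigenvalue -1 imposes nothing,
  while an eigenvalue 1 forces the coordinate to vanish because 2 is nonzero.\<close>

lemma clifford_lie_eq:
  "clifford_lie r s = coord_subspace {J \<in> Pow {1..r + s}. card J mod 4 \<in> {1, 2}}"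
proof -
  have "conj_rev x = \<ominus>\<^bsub>Cl\<^esub> x \<longleftrightarrow>
      (\<forall>J. J \<notin> {J \<in> Pow {1..r + s}. card J mod 4 \<in> {1, 2}} \<longrightarrow> coord J x = 0)"
    if x: "x \<in> carrier Cl" for x
  proof -
    have "conj_rev x = \<ominus>\<^bsub>Cl\<^esub> x \<longleftrightarrow> (\<forall>J. rev_sign (card J) * coord J x = - coord J x)"
      using x coord_eqI[of "conj_rev x" "\<ominus>\<^bsub>Cl\<^esub> x"]
      by (metis Cl.a_inv_closed conj_rev_closed coord_conj_rev coord_uminus)
    moreover have "rev_sign (card J) * coord J x = - coord J x \<longleftrightarrow>
        card J mod 4 \<in> {1, 2} \<or> coord J x = 0" for J
    proof -
      have "a = - a \<longleftrightarrow> a = 0" for a :: 'a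
        using two_neq_0 by (metis add_eq_0_iff mult_2 mult_eq_0_iff neg_equal_0_iff_equal)
      then show ?thesis by (auto simp: rev_sign_def)
    qed
    ultimately show ?thesis using coord_outside[OF x] by auto
  qed
  then show ?thesis by (auto simp: clifford_lie_def clifford_conj_eq coord_subspace_def)
qed

end

subsection \<open>Counting\<close>

text \<open>Subsets of \<open>insert x A\<close> split according to whether they contain
  \<open>x\<close>, which yields a factor \<open>1 + z\<close> for each element.\<close>

lemma sum_Pow_power_card:
  fixes z :: "'a::comm_ring_1"
  assumes "finite A"
  shows "(\<Sum>J\<in>Pow A. z ^ card J) = (1 + z) ^ card A"
  using assms
proof (induction A rule: finite_induct)
  case (insert x A)
  have "(\<Sum>J\<in>insert x ` Pow A. z ^ card J) = (\<Sum>J\<in>Pow A. z * z ^ card J)"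
  proof (subst sum.reindex)
    show "inj_on (insert x) (Pow A)" using insert.hyps by (auto simp: inj_on_def)
    show "sum ((\<lambda>J. z ^ card J) \<circ> insert x) (Pow A) = (\<Sum>J\<in>Pow A. z * z ^ card J)"
    proof (rule sum.cong)
      fix J assume "J \<in> Pow A"
      then have "finite J" "x \<notin> J" using insert.hyps finite_subset by auto
      then show "((\<lambda>J. z ^ card J) \<circ> insert x) J = z * z ^ card J" by simp
    qed simp
  qed
  moreover have "Pow A \<inter> insert x ` Pow A = {}" using insert.hyps by auto
  ultimately have "(\<Sum>J\<in>Pow (insert x A). z ^ card J) =
      (\<Sum>J\<in>Pow A. z ^ card J) + z * (\<Sum>J\<in>Pow A. z ^ card J)"
    using insert.hyps by (simp add: Pow_insert sum.union_disjoint sum_distrib_left)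
  also have "\<dots> = (1 + z) ^ card (insert x A)"
    using insert.hyps by (simp add: insert.IH algebra_simps)
  finally show ?case .
qed simp

text \<open>The numbers (1 + i) i^k run through 1 + i, -1 + i, -1 - i, 1 - i with period 4.\<close>

lemma Re_rev_sign: "Re ((1 + \<i>) * \<i> ^ k) = rev_sign k"
proof -
  define m where "m = k mod 4"
  have "\<i> ^ k = \<i> ^ (4 * (k div 4) + m)" by (simp add: m_def)
  also have "\<dots> = (\<i> ^ 4) ^ (k div 4) * \<i> ^ m" by (simp only: power_add power_mult)
  also have "\<i> ^ 4 = 1" by (simp add: numeral_eq_Suc)
  finally have "\<i> ^ k = \<i> ^ m" by simp
  moreover have "rev_sign k = (if m \<in> {1, 2} then -1 else 1 :: real)"
    by (simp add: rev_sign_def m_def)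
  moreover have "m = 0 \<or> m = 1 \<or> m = 2 \<or> m = 3" unfolding m_def by presburger
  ultimately show ?thesis by (elim disjE) (simp_all add: power3_eq_cube)
qed

text \<open>Summing \<open>rev_sign\<close> over all subsets gives 2^n minus twice the count. The
  same sum is the real part of (1 + i)^(n+1).\<close>

lemma card_subsets_mod_4:
  assumes "n > 0"
  shows "real (card {J \<in> Pow {1..n}. card J mod 4 \<in> {1, 2}}) =
    2 ^ (n - 1) - 2 powr ((real n - 1) / 2) * cos ((real n + 1) * pi / 4)"
proof -
  let ?P = "Pow {1..n}" and ?S = "{J \<in> Pow {1..n}. card J mod 4 \<in> {1, 2}}"
  have "(\<Sum>J\<in>?P. rev_sign (card J) :: real) = Re ((1 + \<i>) * (\<Sum>J\<in>?P. \<i> ^ card J))"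
    by (simp only: sum_distrib_left Re_sum Re_rev_sign)
  also have "\<dots> = Re ((1 + \<i>) ^ Suc n)" by (simp add: sum_Pow_power_card)
  \<comment> \<open>The polar form turns the power into a modulus and the cosine of the
    claim.\<close>
  also have "1 + \<i> = rcis (sqrt 2) (pi / 4)"
    by (simp add: complex_eq_iff cos_45 sin_45)
  also have "Re (rcis (sqrt 2) (pi / 4) ^ Suc n) = sqrt 2 ^ Suc n * cos ((real n + 1) * pi / 4)"
    by (simp only: DeMoivre2 Re_rcis) (simp add: algebra_simps)
  \<comment> \<open>The factor 2 is split off because the count appears doubled below.\<close>
  also have "sqrt 2 ^ Suc n = 2 * 2 powr ((real n - 1) / 2)"
  proof -
    have "sqrt 2 ^ Suc n = (2 powr (1 / 2)) powr real (Suc n)"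
      by (subst powr_realpow) (simp_all only: powr_half_sqrt[of 2, simplified], simp)
    also have "\<dots> = 2 powr (1 + (real n - 1) / 2)"
      unfolding powr_powr by (simp add: field_simps)
    also have "\<dots> = 2 * 2 powr ((real n - 1) / 2)" unfolding powr_add by simp
    finally show ?thesis .
  qed
  finally have sum: "(\<Sum>J\<in>?P. rev_sign (card J) :: real) =
      2 * 2 powr ((real n - 1) / 2) * cos ((real n + 1) * pi / 4)" .
  have "(\<Sum>J\<in>?P. rev_sign (card J) :: real) = (\<Sum>J\<in>?P. 1 - 2 * (if J \<in> ?S then 1 else 0))"
    by (intro sum.cong) (auto simp: rev_sign_def)
  also have "\<dots> = 2 ^ n - 2 * real (card ?S)"
  proof -
    have "(\<Sum>J\<in>?P. if J \<in> ?S then 1 else 0 :: real) = (\<Sum>J\<in>?S. 1)"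
      by (intro sum.mono_neutral_cong_right) auto
    then show ?thesis by (simp add: sum_subtractf card_Pow flip: sum_distrib_left)
  qed
  finally have "2 * real (card ?S) = 2 ^ n - (\<Sum>J\<in>?P. rev_sign (card J))" by simp
  \<comment> \<open>The assumption \<open>n > 0\<close> enters here, since \<open>n - 1\<close> is a
    truncated difference.\<close>
  moreover have "(2::real) ^ n = 2 * 2 ^ (n - 1)" using assms by (cases n) auto
  ultimately show ?thesis unfolding sum by simp
qed

theorem proposition2p9:
  fixes r s :: nat
  assumes "CHAR('a::field) \<noteq> 2"
    and "s > 0"
  defines "Cl \<equiv> (clifford r s :: (nat list \<Rightarrow> 'a) set ring)"
    and "F \<equiv> (clifford_scalars r s :: (nat list \<Rightarrow> 'a) set set)"
    and "G \<equiv> (clifford_lie r s :: (nat list \<Rightarrow> 'a) set set)"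
  shows "ring.finite_dimension Cl F G \<and>
    real ((ring.dim Cl over F) G) =
      2 ^ (r + s - 1) - 2 powr ((real r + real s - 1) / 2) * cos ((real r + real s + 1) * pi / 4)"
proof -
  let ?S = "{J \<in> Pow {1..r + s}. card J mod 4 \<in> {1, 2}}"
  have "(2 :: 'a) \<noteq> 0"
  proof
    assume "(2 :: 'a) = 0"
    \<comment> \<open>A characteristic dividing 2 is 1 or 2, and 1 is impossible in a field.\<close>
    then have "CHAR('a) dvd 2" using of_nat_eq_0_iff_char_dvd[where 'a = 'a, of 2] by simp
    then have "CHAR('a) \<le> 2" by (rule dvd_imp_le) simp
    moreover have "CHAR('a) \<noteq> 0" using \<open>CHAR('a) dvd 2\<close> by (metis dvd_0_left_iff zero_neq_numeral)
    moreover have "CHAR('a) \<noteq> 1" by simp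
    ultimately show False using assms(1) by linarith
  qed
  then interpret C: clifford_char_neq_2 r s "TYPE('a)" by unfold_locales
  have "C.Cl.dimension (card ?S) (clifford_scalars r s) (clifford_lie r s)"
    unfolding C.clifford_lie_eq by (rule C.dimension_coord_subspace) auto
  then have "C.Cl.finite_dimension F G" "(C.Cl.dim over F) G = card ?S"
    unfolding F_def G_def
    using C.Cl.dimI[OF C.subfield_clifford_scalars] C.Cl.finite_dimensionI by blast+
  \<comment> \<open>From \<open>s > 0\<close> the number of basis vectors is positive, as the count
    requires.\<close>
  then show ?thesis
    using card_subsets_mod_4[of "r + s"] assms(2) by (simp add: Cl_def)
qed

end
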